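(* Let $(\mathbf{M},\mathbf{N})$ (with $U,\mathbf{T},\iota,\mathbf{P},\mu$) be an $\mathrm{IMLU}$-category. Then the category $\mathbf{SCan}_{(\mathbf{M},\mathbf{N})}$ of strongly Cantorian objects is a topos.
   Context: A Heyting category has finite limits, images, covers stable under pullback, each poset $\mathrm{Sub}_X$ of subobjects a sup-semilattice, and for each $f:X\to Y$ the inverse image functor $f^*:\mathrm{Sub}_Y\to\mathrm{Sub}_X$ preserves finite suprema and has left and right adjoints. A Heyting subcategory is a subcategory whose inclusion functor preserves this structure; a subcategory is conservative if its inclusion functor reflects isomorphisms. An $\mathrm{IMLU}$-category is a pair $(\mathbf{M},\mathbf{N})$ of Heyting categories such that: $\mathbf{N}$ is a conservative Heyting subcategory of $\mathbf{M}$; there is an object $U$ of $\mathbf{N}$ universal in $\mathbf{N}$ (every object of $\mathbf{N}$ has a mono into $U$ in $\mathbf{N}$); there is an endofunctor $\mathbf{T}$ of $\mathbf{M}$ restricting to an endofunctor of $\mathbf{N}$, with a natural isomorphism $\iota:\mathrm{id}_{\mathbf{M}}\to\mathbf{T}$ on $\mathbf{M}$; there is an endofunctor $\mathbf{P}$ of $\mathbf{N}$ such that for each $A$ in $\mathbf{N}$ there is a morphism $m_{\subseteq^{\mathbf{T}}_A}:\ \subseteq^{\mathbf{T}}_A\ \to\mathbf{T}A\times\mathbf{P}A$ in $\mathbf{N}$, monic in $\mathbf{M}$, such that for any $r:R\to\mathbf{T}A\times B$ in $\mathbf{N}$ that is monic in $\mathbf{M}$ there is $\chi:B\to\mathbf{P}A$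 in $\mathbf{N}$ which is the unique morphism in $\mathbf{M}$ such that $r$ is a pullback in $\mathbf{M}$ of $m_{\subseteq^{\mathbf{T}}_A}$ along $\mathrm{id}\times\chi$; and there is a natural isomorphism $\mu:\mathbf{P}\circ\mathbf{T}\to\mathbf{T}\circ\mathbf{P}$ on $\mathbf{N}$. An object $X$ of $\mathbf{N}$ is strongly Cantorian if $\iota_X:X\to\mathbf{T}X$ is an isomorphism in $\mathbf{N}$ (in particular a morphism of $\mathbf{N}$). $\mathbf{SCan}_{(\mathbf{M},\mathbf{N})}$ is the full subcategory of $\mathbf{N}$ on the strongly Cantorian objects. A topos is a category with finite limits and power objects. *)

theory Defs
  imports "HOL-Algebra.Galois_Connection"
begin

section \<open>Categories, functors, natural isomorphisms\<close>

record ('o, 'm) category =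
  Obj :: "'o set"
  Arr :: "'m set"
  Dom :: "'m \<Rightarrow> 'o"
  Cod :: "'m \<Rightarrow> 'o"
  Id :: "'o \<Rightarrow> 'm"
  Comp :: "'m \<Rightarrow> 'm \<Rightarrow> 'm" (infixr \<open>\<cdot>\<index>\<close> 70)

text \<open>\<open>g \<cdot>\<^bsub>C\<^esub> f\<close> is "first \<open>f\<close>, then \<open>g\<close>".\<close>

definition hom :: "('o, 'm) category \<Rightarrow> 'o \<Rightarrow> 'o \<Rightarrow> 'm set" where
  "hom C X Y = {f \<in> Arr C. Dom C f = X \<and> Cod C f = Y}"

locale category =
  fixes C :: "('o, 'm) category" (structure)
  assumes Dom_in_Obj: "f \<in> Arr C \<Longrightarrow> Dom C f \<in> Obj C"
    and Cod_in_Obj: "f \<in> Arr C \<Longrightarrow> Cod C f \<in> Obj C"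
    and Id_in_hom: "X \<in> Obj C \<Longrightarrow> Id C X \<in> hom C X X"
    and Comp_in_hom: "\<lbrakk>f \<in> hom C X Y; g \<in> hom C Y Z\<rbrakk> \<Longrightarrow> g \<cdot> f \<in> hom C X Z"
    and Comp_Id: "f \<in> hom C X Y \<Longrightarrow> f \<cdot> Id C X = f"
    and Id_Comp: "f \<in> hom C X Y \<Longrightarrow> Id C Y \<cdot> f = f"
    and Comp_assoc: "\<lbrakk>f \<in> hom C W X; g \<in> hom C X Y; h \<in> hom C Y Z\<rbrakk>
      \<Longrightarrow> (h \<cdot> g) \<cdot> f = h \<cdot> (g \<cdot> f)"

definition monic :: "('o, 'm) category \<Rightarrow> 'm \<Rightarrow> bool" where
  "monic C m \<longleftrightarrow> m \<in> Arr C \<and>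
     (\<forall>X. \<forall>f \<in> hom C X (Dom C m). \<forall>g \<in> hom C X (Dom C m). m \<cdot>\<^bsub>C\<^esub> f = m \<cdot>\<^bsub>C\<^esub> g \<longrightarrow> f = g)"

definition is_iso :: "('o, 'm) category \<Rightarrow> 'm \<Rightarrow> bool" where
  "is_iso C f \<longleftrightarrow> f \<in> Arr C \<and>
     (\<exists>g \<in> hom C (Cod C f) (Dom C f).
        g \<cdot>\<^bsub>C\<^esub> f = Id C (Dom C f) \<and> f \<cdot>\<^bsub>C\<^esub> g = Id C (Cod C f))"

record ('o, 'm, 'p, 'n) functor_data =
  obj_map :: "'o \<Rightarrow> 'p"
  arr_map :: "'m \<Rightarrow> 'n"

locale is_functor = C: category C + D: category D
  for C :: "('o, 'm) category" and D :: "('p, 'n) category" and F :: "('o, 'm, 'p, 'n) functor_data" +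
  assumes obj_map_in_Obj: "X \<in> Obj C \<Longrightarrow> obj_map F X \<in> Obj D"
    and arr_map_in_hom: "f \<in> hom C X Y \<Longrightarrow> arr_map F f \<in> hom D (obj_map F X) (obj_map F Y)"
    and arr_map_Id: "X \<in> Obj C \<Longrightarrow> arr_map F (Id C X) = Id D (obj_map F X)"
    and arr_map_Comp: "\<lbrakk>f \<in> hom C X Y; g \<in> hom C Y Z\<rbrakk>
      \<Longrightarrow> arr_map F (g \<cdot>\<^bsub>C\<^esub> f) = arr_map F g \<cdot>\<^bsub>D\<^esub> arr_map F f"

definition id_functor :: "('o, 'm, 'o, 'm) functor_data" where
  "id_functor = \<lparr>obj_map = (\<lambda>X. X), arr_map = (\<lambda>f. f)\<rparr>"

definition comp_functor ::
    "('p, 'n, 'q, 'k) functor_data \<Rightarrow> ('o, 'm, 'p, 'n) functor_data \<Rightarrow> ('o, 'm, 'q, 'k) functor_data"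
    (infixr \<open>\<circ>\<^sub>F\<close> 75) where
  "G \<circ>\<^sub>F F = \<lparr>obj_map = obj_map G \<circ> obj_map F, arr_map = arr_map G \<circ> arr_map F\<rparr>"

definition natural_iso ::
    "('o, 'm) category \<Rightarrow> ('p, 'n) category
      \<Rightarrow> ('o, 'm, 'p, 'n) functor_data \<Rightarrow> ('o, 'm, 'p, 'n) functor_data \<Rightarrow> ('o \<Rightarrow> 'n) \<Rightarrow> bool" where
  "natural_iso C D F G \<alpha> \<longleftrightarrow> is_functor C D F \<and> is_functor C D G \<and>
     (\<forall>X \<in> Obj C. \<alpha> X \<in> hom D (obj_map F X) (obj_map G X) \<and> is_iso D (\<alpha> X)) \<and>
     (\<forall>X Y. \<forall>f \<in> hom C X Y. arr_map G f \<cdot>\<^bsub>D\<^esub> \<alpha> X = \<alpha> Y \<cdot>\<^bsub>D\<^esub> arr_map F f)"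

definition conservative :: "('o, 'm) category \<Rightarrow> ('p, 'n) category \<Rightarrow> ('o, 'm, 'p, 'n) functor_data \<Rightarrow> bool" where
  "conservative C D F \<longleftrightarrow> (\<forall>f \<in> Arr C. is_iso D (arr_map F f) \<longrightarrow> is_iso C f)"

definition subcategory :: "('o, 'm) category \<Rightarrow> ('o, 'm) category \<Rightarrow> bool" where
  "subcategory N M \<longleftrightarrow> category N \<and> category M \<and> Obj N \<subseteq> Obj M \<and> Arr N \<subseteq> Arr M \<and>
     (\<forall>f \<in> Arr N. Dom N f = Dom M f \<and> Cod N f = Cod M f) \<and>
     (\<forall>X \<in> Obj N. Id N X = Id M X) \<and>
     (\<forall>X Y Z. \<forall>f \<in> hom N X Y. \<forall>g \<in> hom N Y Z. g \<cdot>\<^bsub>N\<^esub> f = g \<cdot>\<^bsub>M\<^esub> f)"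

definition full_subcategory_on :: "('o, 'm) category \<Rightarrow> 'o set \<Rightarrow> ('o, 'm) category" where
  "full_subcategory_on C S =
     C\<lparr>Obj := Obj C \<inter> S, Arr := {f \<in> Arr C. Dom C f \<in> S \<and> Cod C f \<in> S}\<rparr>"

section \<open>Limits\<close>

definition cone ::
    "('i, 'j) category \<Rightarrow> ('o, 'm) category \<Rightarrow> ('i, 'j, 'o, 'm) functor_data \<Rightarrow> 'o \<Rightarrow> ('i \<Rightarrow> 'm) \<Rightarrow> bool" where
  "cone J C G L \<pi> \<longleftrightarrow> L \<in> Obj C \<and> (\<forall>i \<in> Obj J. \<pi> i \<in> hom C L (obj_map G i)) \<and>
     (\<forall>i j. \<forall>u \<in> hom J i j. arr_map G u \<cdot>\<^bsub>C\<^esub> \<pi> i = \<pi> j)"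

definition limit_cone ::
    "('i, 'j) category \<Rightarrow> ('o, 'm) category \<Rightarrow> ('i, 'j, 'o, 'm) functor_data \<Rightarrow> 'o \<Rightarrow> ('i \<Rightarrow> 'm) \<Rightarrow> bool" where
  "limit_cone J C G L \<pi> \<longleftrightarrow> cone J C G L \<pi> \<and>
     (\<forall>L' \<pi>'. cone J C G L' \<pi>' \<longrightarrow>
        (\<exists>!h. h \<in> hom C L' L \<and> (\<forall>i \<in> Obj J. \<pi> i \<cdot>\<^bsub>C\<^esub> h = \<pi>' i)))"

definition finite_category :: "('i, 'j) category \<Rightarrow> bool" where
  "finite_category J \<longleftrightarrow> category J \<and> finite (Obj J) \<and> finite (Arr J)"

text \<open>Every finite category is isomorphic to one whose objects and arrows are natural numbers,
  so these suffice as index categories.\<close>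

definition has_finite_limits :: "('o, 'm) category \<Rightarrow> bool" where
  "has_finite_limits C \<longleftrightarrow>
     (\<forall>(J :: (nat, nat) category) G. finite_category J \<and> is_functor J C G \<longrightarrow>
        (\<exists>L \<pi>. limit_cone J C G L \<pi>))"

definition preserves_finite_limits ::
    "('o, 'm) category \<Rightarrow> ('p, 'n) category \<Rightarrow> ('o, 'm, 'p, 'n) functor_data \<Rightarrow> bool" where
  "preserves_finite_limits C D F \<longleftrightarrow>
     (\<forall>(J :: (nat, nat) category) G L \<pi>.
        finite_category J \<and> is_functor J C G \<and> limit_cone J C G L \<pi> \<longrightarrow>
        limit_cone J D (F \<circ>\<^sub>F G) (obj_map F L) (arr_map F \<circ> \<pi>))"

definition is_product ::
    "('o, 'm) category \<Rightarrow> 'o \<Rightarrow> 'o \<Rightarrow> 'o \<Rightarrow> 'm \<Rightarrow> 'm \<Rightarrow> bool" where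
  "is_product C A B W p q \<longleftrightarrow> W \<in> Obj C \<and> p \<in> hom C W A \<and> q \<in> hom C W B \<and>
     (\<forall>X. \<forall>f \<in> hom C X A. \<forall>g \<in> hom C X B.
        \<exists>!h. h \<in> hom C X W \<and> p \<cdot>\<^bsub>C\<^esub> h = f \<and> q \<cdot>\<^bsub>C\<^esub> h = g)"

text \<open>\<open>is_pullback C f g p q\<close>: the square \<open>f \<cdot> p = g \<cdot> q\<close> is a pullback of the cospan \<open>f, g\<close>;
  so \<open>p\<close> is the pullback of \<open>g\<close> along \<open>f\<close>.\<close>

definition is_pullback :: "('o, 'm) category \<Rightarrow> 'm \<Rightarrow> 'm \<Rightarrow> 'm \<Rightarrow> 'm \<Rightarrow> bool" where
  "is_pullback C f g p q \<longleftrightarrow>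
     f \<in> Arr C \<and> g \<in> Arr C \<and> Cod C f = Cod C g \<and>
     p \<in> Arr C \<and> q \<in> Arr C \<and> Dom C p = Dom C q \<and> Cod C p = Dom C f \<and> Cod C q = Dom C g \<and>
     f \<cdot>\<^bsub>C\<^esub> p = g \<cdot>\<^bsub>C\<^esub> q \<and>
     (\<forall>X. \<forall>a \<in> hom C X (Dom C f). \<forall>b \<in> hom C X (Dom C g). f \<cdot>\<^bsub>C\<^esub> a = g \<cdot>\<^bsub>C\<^esub> b \<longrightarrow>
        (\<exists>!h. h \<in> hom C X (Dom C p) \<and> p \<cdot>\<^bsub>C\<^esub> h = a \<and> q \<cdot>\<^bsub>C\<^esub> h = b))"

section \<open>Subobjects, images, covers\<close>

definition factors_through :: "('o, 'm) category \<Rightarrow> 'm \<Rightarrow> 'm \<Rightarrow> bool" where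
  "factors_through C f m \<longleftrightarrow> (\<exists>g \<in> hom C (Dom C f) (Dom C m). f = m \<cdot>\<^bsub>C\<^esub> g)"

definition monos_into :: "('o, 'm) category \<Rightarrow> 'o \<Rightarrow> 'm set" where
  "monos_into C X = {m. monic C m \<and> Cod C m = X}"

definition mono_equiv :: "('o, 'm) category \<Rightarrow> 'o \<Rightarrow> ('m \<times> 'm) set" where
  "mono_equiv C X = {(m, n). m \<in> monos_into C X \<and> n \<in> monos_into C X \<and>
     factors_through C m n \<and> factors_through C n m}"

text \<open>Subobjects are equivalence classes of monos.\<close>

definition Sub :: "('o, 'm) category \<Rightarrow> 'o \<Rightarrow> 'm set gorder" where
  "Sub C X = \<lparr>carrier = monos_into C X // mono_equiv C X, eq = (=),
     le = (\<lambda>S S'. \<exists>m \<in> S. \<exists>n \<in> S'. factors_through C m n)\<rparr>"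

definition image_of :: "('o, 'm) category \<Rightarrow> 'm \<Rightarrow> 'm \<Rightarrow> bool" where
  "image_of C f m \<longleftrightarrow> m \<in> monos_into C (Cod C f) \<and> factors_through C f m \<and>
     (\<forall>n \<in> monos_into C (Cod C f). factors_through C f n \<longrightarrow> factors_through C m n)"

definition has_images :: "('o, 'm) category \<Rightarrow> bool" where
  "has_images C \<longleftrightarrow> (\<forall>f \<in> Arr C. \<exists>m. image_of C f m)"

definition cover :: "('o, 'm) category \<Rightarrow> 'm \<Rightarrow> bool" where
  "cover C f \<longleftrightarrow> f \<in> Arr C \<and>
     (\<forall>m \<in> monos_into C (Cod C f). factors_through C f m \<longrightarrow> is_iso C m)"

definition covers_stable :: "('o, 'm) category \<Rightarrow> bool" where
  "covers_stable C \<longleftrightarrow> (\<forall>f g p q. cover C g \<and> is_pullback C f g p q \<longrightarrow> cover C p)"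

text \<open>The pullbacks along \<open>f\<close> of the representatives of a subobject of the codomain form a single
  equivalence class of monos into the domain.\<close>

definition inverse_image :: "('o, 'm) category \<Rightarrow> 'm \<Rightarrow> 'm set \<Rightarrow> 'm set" where
  "inverse_image C f S = {p. \<exists>n \<in> S. \<exists>q. is_pullback C f n p q}"

text \<open>A finite set may be empty: sup-semilattices have a least element, and preservation of finite
  suprema includes it.\<close>

definition sup_semilattice :: "'a gorder \<Rightarrow> bool" where
  "sup_semilattice L \<longleftrightarrow> partial_order L \<and>
     (\<forall>A. A \<subseteq> carrier L \<and> finite A \<longrightarrow> (\<exists>s. is_lub L s A))"

definition preserves_finite_sups :: "'a gorder \<Rightarrow> 'b gorder \<Rightarrow> ('a \<Rightarrow> 'b) \<Rightarrow> bool" where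
  "preserves_finite_sups L L' h \<longleftrightarrow> h \<in> carrier L \<rightarrow> carrier L' \<and>
     (\<forall>A s. A \<subseteq> carrier L \<and> finite A \<and> is_lub L s A \<longrightarrow> is_lub L' (h s) (h ` A))"

definition adjoint :: "'a gorder \<Rightarrow> 'b gorder \<Rightarrow> ('a \<Rightarrow> 'b) \<Rightarrow> ('b \<Rightarrow> 'a) \<Rightarrow> bool" where
  "adjoint L L' l r \<longleftrightarrow> galois_connection \<lparr>orderA = L, orderB = L', lower = l, upper = r\<rparr>"

definition exists_along :: "('o, 'm) category \<Rightarrow> 'm \<Rightarrow> ('m set \<Rightarrow> 'm set) \<Rightarrow> bool" where
  "exists_along C f l \<longleftrightarrow> adjoint (Sub C (Dom C f)) (Sub C (Cod C f)) l (inverse_image C f)"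

definition forall_along :: "('o, 'm) category \<Rightarrow> 'm \<Rightarrow> ('m set \<Rightarrow> 'm set) \<Rightarrow> bool" where
  "forall_along C f r \<longleftrightarrow> adjoint (Sub C (Cod C f)) (Sub C (Dom C f)) (inverse_image C f) r"

section \<open>Heyting categories\<close>

locale heyting_category = category +
  assumes finite_limits: "has_finite_limits C"
    and images: "has_images C"
    and stable_covers: "covers_stable C"
    and Sub_sup_semilattice: "X \<in> Obj C \<Longrightarrow> sup_semilattice (Sub C X)"
    and inverse_image_sups: "f \<in> Arr C \<Longrightarrow>
      preserves_finite_sups (Sub C (Cod C f)) (Sub C (Dom C f)) (inverse_image C f)"
    and left_adjoint: "f \<in> Arr C \<Longrightarrow> \<exists>l. exists_along C f l"
    and right_adjoint: "f \<in> Arr C \<Longrightarrow> \<exists>r. forall_along C f r"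

text \<open>The action of a mono-preserving functor on subobjects of \<open>X\<close>.\<close>

definition sub_map ::
    "('p, 'n) category \<Rightarrow> ('o, 'm, 'p, 'n) functor_data \<Rightarrow> 'o \<Rightarrow> 'm set \<Rightarrow> 'n set" where
  "sub_map D F X S = mono_equiv D (obj_map F X) `` (arr_map F ` S)"

text \<open>Adjoints between posets are unique, so the last two conditions range over the only candidates.\<close>

locale heyting_functor = is_functor C D F + C: heyting_category C + D: heyting_category D
  for C :: "('o, 'm) category" and D :: "('p, 'n) category" and F :: "('o, 'm, 'p, 'n) functor_data" +
  assumes preserves_limits: "preserves_finite_limits C D F"
    and preserves_images: "\<lbrakk>f \<in> Arr C; image_of C f m\<rbrakk> \<Longrightarrow> image_of D (arr_map F f) (arr_map F m)"
    and preserves_sups: "X \<in> Obj C \<Longrightarrow>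
      preserves_finite_sups (Sub C X) (Sub D (obj_map F X)) (sub_map D F X)"
    and preserves_exists: "\<lbrakk>f \<in> Arr C; exists_along C f l; exists_along D (arr_map F f) l';
        S \<in> carrier (Sub C (Dom C f))\<rbrakk>
      \<Longrightarrow> sub_map D F (Cod C f) (l S) = l' (sub_map D F (Dom C f) S)"
    and preserves_forall: "\<lbrakk>f \<in> Arr C; forall_along C f r; forall_along D (arr_map F f) r';
        S \<in> carrier (Sub C (Dom C f))\<rbrakk>
      \<Longrightarrow> sub_map D F (Cod C f) (r S) = r' (sub_map D F (Dom C f) S)"

definition heyting_subcategory :: "('o, 'm) category \<Rightarrow> ('o, 'm) category \<Rightarrow> bool" where
  "heyting_subcategory N M \<longleftrightarrow> subcategory N M \<and> heyting_functor N M id_functor"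

section \<open>Power objects and toposes\<close>

text \<open>Given products \<open>(W, p, q)\<close> of \<open>A, PA\<close> and \<open>(V, p', q')\<close> of \<open>A, B\<close>, and \<open>\<chi> : B \<rightarrow> PA\<close>:
  \<open>r\<close> is a pullback of \<open>m\<close> along \<open>id \<times> \<chi>\<close>, where \<open>id \<times> \<chi>\<close> is the arrow \<open>h\<close>.\<close>

definition pullback_along_id_times ::
    "('o, 'm) category \<Rightarrow> 'o \<Rightarrow> 'm \<Rightarrow> 'm \<Rightarrow> 'm \<Rightarrow> 'o \<Rightarrow> 'm \<Rightarrow> 'm \<Rightarrow> 'm \<Rightarrow> 'm \<Rightarrow> bool" where
  "pullback_along_id_times C W p q m V p' q' r \<chi> \<longleftrightarrow>
     (\<exists>h \<in> hom C V W. p \<cdot>\<^bsub>C\<^esub> h = p' \<and> q \<cdot>\<^bsub>C\<^esub> h = \<chi> \<cdot>\<^bsub>C\<^esub> q' \<and> (\<exists>k. is_pullback C h m r k))"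

definition has_power_objects :: "('o, 'm) category \<Rightarrow> bool" where
  "has_power_objects C \<longleftrightarrow>
     (\<forall>A \<in> Obj C. \<exists>PA \<in> Obj C. \<exists>W p q m.
        is_product C A PA W p q \<and> m \<in> monos_into C W \<and>
        (\<forall>B \<in> Obj C. \<forall>V p' q' r. is_product C A B V p' q' \<and> r \<in> monos_into C V \<longrightarrow>
           (\<exists>!\<chi>. \<chi> \<in> hom C B PA \<and> pullback_along_id_times C W p q m V p' q' r \<chi>)))"

definition topos :: "('o, 'm) category \<Rightarrow> bool" where
  "topos C \<longleftrightarrow> category C \<and> has_finite_limits C \<and> has_power_objects C"

section \<open>IMLU-categories\<close>

locale IMLU_category =
  fixes M N :: "('o, 'm) category"
    and U :: 'o
    and T :: "('o, 'm, 'o, 'm) functor_data"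
    and \<iota> :: "'o \<Rightarrow> 'm"
    and P :: "('o, 'm, 'o, 'm) functor_data"
    and \<mu> :: "'o \<Rightarrow> 'm"
  assumes heyting_M: "heyting_category M"
    and heyting_N: "heyting_category N"
    and heyting_sub: "heyting_subcategory N M"
    and conservative_sub: "conservative N M id_functor"
    and U_in_Obj: "U \<in> Obj N"
    and U_universal: "X \<in> Obj N \<Longrightarrow> \<exists>m \<in> hom N X U. monic N m"
    and T_endo_M: "is_functor M M T"
    and T_endo_N: "is_functor N N T"
    and iota_iso: "natural_iso M M id_functor T \<iota>"
    and P_endo: "is_functor N N P"
    and power: "A \<in> Obj N \<Longrightarrow>
      \<exists>E W p q. \<exists>m \<in> hom N E W. is_product N (obj_map T A) (obj_map P A) W p q \<and> monic M m \<and>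
        (\<forall>B \<in> Obj N. \<forall>V p' q' R. \<forall>r \<in> hom N R V.
           is_product N (obj_map T A) B V p' q' \<and> monic M r \<longrightarrow>
           (\<exists>\<chi> \<in> hom N B (obj_map P A).
              pullback_along_id_times M W p q m V p' q' r \<chi> \<and>
              (\<forall>\<chi>' \<in> hom M B (obj_map P A).
                 pullback_along_id_times M W p q m V p' q' r \<chi>' \<longrightarrow> \<chi>' = \<chi>)))"
    and mu_iso: "natural_iso N N (P \<circ>\<^sub>F T) (T \<circ>\<^sub>F P) \<mu>"

definition strongly_Cantorian :: "('o, 'm) category \<Rightarrow> ('o \<Rightarrow> 'm) \<Rightarrow> 'o \<Rightarrow> bool" where
  "strongly_Cantorian N \<iota> X \<longleftrightarrow> X \<in> Obj N \<and> is_iso N (\<iota> X)"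

definition SCan :: "('o, 'm) category \<Rightarrow> ('o \<Rightarrow> 'm) \<Rightarrow> ('o, 'm) category" where
  "SCan N \<iota> = full_subcategory_on N {X. strongly_Cantorian N \<iota> X}"

end

theory Submission
  imports Defs
begin

text \<open>Every step below follows one pattern: an arrow of the large category \<open>M\<close> turns out to lie in
  the small category \<open>N\<close>. Two principles produce such arrows. Conservativity says that if an arrow of
  \<open>N\<close> has an inverse in \<open>M\<close>, the inverse lies in \<open>N\<close>. Hence, if \<open>f\<close> and \<open>g\<close> are arrows of \<open>N\<close>,
  \<open>g\<close> is monic and \<open>f = g \<cdot> a\<close> in \<open>M\<close>, then \<open>a\<close> lies in \<open>N\<close> (\<open>factor_in_N\<close>): the pullback \<open>p\<close> of \<open>g\<close>
  along \<open>f\<close>, taken in \<open>N\<close>, has a section induced by \<open>a\<close> and is thus invertible.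

  Because \<open>\<iota>\<close> consists of isomorphisms of \<open>M\<close>, an object \<open>X\<close> of \<open>N\<close> is strongly Cantorian exactly
  when the single arrow \<open>\<iota> X\<close>, or equivalently its inverse, lies in \<open>N\<close>.

  \<^item> Subobjects. For a mono \<open>f : X \<rightarrow> Y\<close> of \<open>N\<close> with \<open>Y\<close> strongly Cantorian, naturality reads
    \<open>\<iota> Y \<cdot> f = T f \<cdot> \<iota> X\<close>. The left side is in \<open>N\<close> and \<open>T f\<close> is a mono of \<open>N\<close>, so \<open>\<iota> X\<close> is in \<open>N\<close>.
  \<^item> Finite limits. Let \<open>L\<close> with projections \<open>\<pi> i\<close> be a limit in \<open>N\<close> of a diagram \<open>G\<close> of strongly
    Cantorian objects. The arrows \<open>T (\<pi> i)\<close>, followed by the inverses of \<open>\<iota> (G i)\<close>, form a cone in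
    \<open>N\<close> from \<open>T L\<close>. The arrow \<open>T L \<rightarrow> L\<close> it induces is the inverse of \<open>\<iota> L\<close>, since \<open>L\<close> is also a limit
    in \<open>M\<close>. So finite limits of strongly Cantorian objects may be computed in \<open>N\<close>, and therefore
    monos, products and pullbacks of \<open>SCan\<close> remain such in \<open>N\<close> and in \<open>M\<close>.
  \<^item> Power objects. Let \<open>A\<close> be strongly Cantorian and \<open>m : E \<rightarrow> T A \<times> P A\<close> its membership relation.
    Since \<open>T T A \<cong> T A\<close> in \<open>N\<close>, the arrow \<open>T m\<close> becomes a relation \<open>r : T E \<rightarrow> T A \<times> T (P A)\<close> of \<open>N\<close>.
    In \<open>M\<close>, \<open>r\<close> is the pullback of \<open>m\<close> along \<open>id \<times> j\<close>, where \<open>j\<close> is the inverse of \<open>\<iota> (P A)\<close>.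
    The classifying arrow of \<open>r\<close> is in \<open>N\<close> and is the only one in \<open>M\<close>, so it equals \<open>j\<close>, and \<open>P A\<close>
    is strongly Cantorian (\<open>strongly_Cantorian_P\<close>). Then \<open>E\<close> is strongly Cantorian too, as a
    subobject of the product. Through \<open>A \<cong> T A\<close>, the arrow \<open>m\<close> is a membership relation for \<open>A\<close>
    in \<open>SCan\<close>.\<close>

section \<open>Composition without hom-sets\<close>

text \<open>Typing an arrow by equations for its domain and codomain lets the simplifier discharge the side
  conditions of the category laws, which it cannot do when they mention hom-sets at unknown objects.\<close>

context category
begin

lemma arr_in_hom: "f \<in> Arr C \<Longrightarrow> f \<in> hom C (Dom C f) (Cod C f)"
  by (simp add: hom_def)

lemma Comp_typed:
  assumes "f \<in> Arr C" "g \<in> Arr C" "Cod C f = Dom C g"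
  shows Comp_arr [simp]: "g \<cdot> f \<in> Arr C"
    and Dom_Comp [simp]: "Dom C (g \<cdot> f) = Dom C f"
    and Cod_Comp [simp]: "Cod C (g \<cdot> f) = Cod C g"
  using Comp_in_hom[of f "Dom C f" "Cod C f" g "Cod C g"] assms by (auto simp: hom_def)

lemma Id_typed [simp]:
  assumes "X \<in> Obj C"
  shows "Id C X \<in> Arr C" "Dom C (Id C X) = X" "Cod C (Id C X) = X"
  using Id_in_hom[OF assms] by (auto simp: hom_def)

lemma Comp_Id_arr [simp]: "f \<in> Arr C \<Longrightarrow> Dom C f = X \<Longrightarrow> f \<cdot> Id C X = f"
  by (rule Comp_Id[of _ _ "Cod C f"]) (simp add: hom_def)

lemma Id_Comp_arr [simp]: "f \<in> Arr C \<Longrightarrow> Cod C f = X \<Longrightarrow> Id C X \<cdot> f = f"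
  by (rule Id_Comp[of _ "Dom C f"]) (simp add: hom_def)

lemma Comp_assoc_arr:
  assumes "f \<in> Arr C" "g \<in> Arr C" "h \<in> Arr C" "Cod C f = Dom C g" "Cod C g = Dom C h"
  shows "(h \<cdot> g) \<cdot> f = h \<cdot> (g \<cdot> f)"
  by (rule Comp_assoc[of _ "Dom C f" "Dom C g" _ "Dom C h" _ "Cod C h"])
    (use assms in \<open>auto simp: hom_def\<close>)

end

definition inverse_arrows :: "('o, 'm) category \<Rightarrow> 'm \<Rightarrow> 'm \<Rightarrow> bool" where
  "inverse_arrows C f g \<longleftrightarrow> f \<in> Arr C \<and> g \<in> Arr C \<and> Dom C g = Cod C f \<and> Cod C g = Dom C f \<and>
     g \<cdot>\<^bsub>C\<^esub> f = Id C (Dom C f) \<and> f \<cdot>\<^bsub>C\<^esub> g = Id C (Cod C f)"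

lemma is_iso_iff_inverse_arrows: "is_iso C f \<longleftrightarrow> (\<exists>g. inverse_arrows C f g)"
  by (auto simp: is_iso_def inverse_arrows_def hom_def)

lemma inverse_arrows_sym: "inverse_arrows C f g \<Longrightarrow> inverse_arrows C g f"
  by (auto simp: inverse_arrows_def)

lemma (in category) left_inverse_of_iso:
  assumes "inverse_arrows C f g" "k \<in> Arr C" "Dom C k = Cod C f" "k \<cdot> f = Id C (Dom C f)"
  shows "k = g"
proof -
  note g = assms(1)[unfolded inverse_arrows_def]
  have "k = k \<cdot> (f \<cdot> g)" using g assms by simp
  also have "\<dots> = (k \<cdot> f) \<cdot> g"
    by (rule Comp_assoc_arr[symmetric]) (use g assms in auto)
  also have "\<dots> = g" using g assms by simp
  finally show ?thesis .
qed

section \<open>Binary products and pullbacks as limits of diagrams\<close>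

definition pair_shape :: "(nat, nat) category" where
  "pair_shape = \<lparr>Obj = {0, 1}, Arr = {0, 1}, Dom = (\<lambda>u. u), Cod = (\<lambda>u. u), Id = (\<lambda>i. i),
     Comp = (\<lambda>v u. u)\<rparr>"

definition pair_diagram :: "('o, 'm) category \<Rightarrow> 'o \<Rightarrow> 'o \<Rightarrow> (nat, nat, 'o, 'm) functor_data" where
  "pair_diagram C A B = \<lparr>obj_map = (\<lambda>i. if i = 0 then A else B),
     arr_map = (\<lambda>i. Id C (if i = 0 then A else B))\<rparr>"

text \<open>The arrows \<open>3 : 0 \<rightarrow> 2\<close> and \<open>4 : 1 \<rightarrow> 2\<close> form the cospan; every other arrow is the identity
  of the object with the same number.\<close>

definition cospan_shape :: "(nat, nat) category" where
  "cospan_shape = \<lparr>Obj = {0, 1, 2}, Arr = {0, 1, 2, 3, 4},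
     Dom = (\<lambda>u. if u = 3 then 0 else if u = 4 then 1 else u),
     Cod = (\<lambda>u. if u = 3 \<or> u = 4 then 2 else u),
     Id = (\<lambda>i. i), Comp = (\<lambda>v u. if u < 3 then v else u)\<rparr>"

definition cospan_diagram :: "('o, 'm) category \<Rightarrow> 'm \<Rightarrow> 'm \<Rightarrow> (nat, nat, 'o, 'm) functor_data" where
  "cospan_diagram C f g =
     (let ob = (\<lambda>i. if i = 0 then Dom C f else if i = 1 then Dom C g else Cod C f)
      in \<lparr>obj_map = ob, arr_map = (\<lambda>u. if u = 3 then f else if u = 4 then g else Id C (ob u))\<rparr>)"

lemma finite_pair_shape: "finite_category pair_shape"
  by (auto simp: finite_category_def pair_shape_def category_def hom_def)

lemma finite_cospan_shape: "finite_category cospan_shape"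
  unfolding finite_category_def cospan_shape_def category_def hom_def
  by (auto split: if_splits)

context category
begin

lemma is_functor_pair_diagram:
  assumes "A \<in> Obj C" "B \<in> Obj C"
  shows "is_functor pair_shape C (pair_diagram C A B)"
  using finite_pair_shape assms category_axioms
  by (auto simp: is_functor_def is_functor_axioms_def finite_category_def pair_shape_def
      pair_diagram_def hom_def)

lemma is_functor_cospan_diagram:
  assumes "f \<in> Arr C" "g \<in> Arr C" "Cod C f = Cod C g"
  shows "is_functor cospan_shape C (cospan_diagram C f g)"
proof -
  have "Dom C f \<in> Obj C" "Dom C g \<in> Obj C" "Cod C f \<in> Obj C" "Cod C g \<in> Obj C"
    using assms by (auto intro: Dom_in_Obj Cod_in_Obj)
  then show ?thesis
    using finite_cospan_shape assms category_axioms
    unfolding is_functor_def is_functor_axioms_def finite_category_def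
    by (auto simp: cospan_shape_def cospan_diagram_def hom_def Let_def split: if_splits)
qed

lemma cone_pair_iff:
  assumes "A \<in> Obj C" "B \<in> Obj C"
  shows "cone pair_shape C (pair_diagram C A B) L \<pi> \<longleftrightarrow>
    L \<in> Obj C \<and> \<pi> 0 \<in> hom C L A \<and> \<pi> 1 \<in> hom C L B"
  using assms by (auto simp: cone_def pair_shape_def pair_diagram_def hom_def)

lemma is_product_iff_limit_cone:
  assumes "A \<in> Obj C" "B \<in> Obj C"
  shows "is_product C A B W p q \<longleftrightarrow>
    limit_cone pair_shape C (pair_diagram C A B) W (\<lambda>i. if i = 0 then p else q)"
proof -
  (* The legs of a cone are a function on indices: every pair of arrows f, g extends to one. *)
  have univ: "(\<forall>X. \<forall>f \<in> hom C X A. \<forall>g \<in> hom C X B. \<exists>!h. h \<in> hom C X W \<and> p \<cdot> h = f \<and> q \<cdot> h = g) \<longleftrightarrow>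
    (\<forall>L' \<pi>'. L' \<in> Obj C \<and> \<pi>' 0 \<in> hom C L' A \<and> \<pi>' 1 \<in> hom C L' B \<longrightarrow>
      (\<exists>!h. h \<in> hom C L' W \<and> p \<cdot> h = \<pi>' 0 \<and> q \<cdot> h = \<pi>' (1::nat)))" (is "?l = ?r")
  proof
    assume ?l then show ?r by blast
  next
    assume r: ?r
    show ?l
    proof (intro allI ballI)
      fix X f g assume "f \<in> hom C X A" "g \<in> hom C X B"
      then show "\<exists>!h. h \<in> hom C X W \<and> p \<cdot> h = f \<and> q \<cdot> h = g"
        using r[rule_format, of X "\<lambda>i. if i = 0 then f else g"] Dom_in_Obj
        by (auto simp: hom_def)
    qed
  qed
  have "\<forall>h \<pi>'. (\<forall>i \<in> Obj pair_shape. (if i = 0 then p else q) \<cdot> h = \<pi>' i) \<longleftrightarrow>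
      p \<cdot> h = \<pi>' 0 \<and> q \<cdot> h = \<pi>' 1"
    by (simp add: pair_shape_def)
  then show ?thesis
    unfolding is_product_def limit_cone_def cone_pair_iff[OF assms] univ by simp
qed

lemma cone_cospan_iff:
  assumes "f \<in> Arr C" "g \<in> Arr C" "Cod C f = Cod C g"
  shows "cone cospan_shape C (cospan_diagram C f g) L \<pi> \<longleftrightarrow>
    L \<in> Obj C \<and> \<pi> 0 \<in> hom C L (Dom C f) \<and> \<pi> 1 \<in> hom C L (Dom C g) \<and>
    f \<cdot> \<pi> 0 = \<pi> 2 \<and> g \<cdot> \<pi> 1 = \<pi> 2" (is "?l = ?r")
proof
  assume l: ?l
  have "arr_map (cospan_diagram C f g) u \<cdot> \<pi> i = \<pi> j" if "u \<in> hom cospan_shape i j" for u i j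
    using l that unfolding cone_def by blast
  from this[of 3 0 2] this[of 4 1 2] show ?r
    using l by (auto simp: cone_def cospan_shape_def cospan_diagram_def hom_def)
next
  assume r: ?r
  then have "\<pi> 2 \<in> hom C L (Cod C f)"
    using assms by (metis Comp_in_hom arr_in_hom)
  then show ?l
    using r assms
    by (auto simp: cone_def cospan_shape_def cospan_diagram_def hom_def Let_def split: if_splits)
qed

text \<open>The leg of the cone at the vertex 2 of the cospan is the common composite, which the other two
  legs determine.\<close>

lemma is_pullback_iff_limit_cone:
  assumes "f \<in> Arr C" "g \<in> Arr C" "Cod C f = Cod C g"
    and "p \<in> Arr C" "q \<in> Arr C" "Dom C p = L" "Dom C q = L" "Cod C p = Dom C f" "Cod C q = Dom C g"
  shows "is_pullback C f g p q \<longleftrightarrow>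
    limit_cone cospan_shape C (cospan_diagram C f g) L
      (\<lambda>i. if i = 0 then p else if i = 1 then q else f \<cdot> p)" (is "?l \<longleftrightarrow> limit_cone _ _ _ _ ?\<pi>")
proof
  assume l: ?l
  have "\<exists>!h. h \<in> hom C L' L \<and> (\<forall>i \<in> Obj cospan_shape. ?\<pi> i \<cdot> h = \<pi>' i)"
    if c: "cone cospan_shape C (cospan_diagram C f g) L' \<pi>'" for L' \<pi>'
  proof -
    note c = c[unfolded cone_cospan_iff[OF assms(1-3)]]
    then have ex: "\<exists>!h. h \<in> hom C L' L \<and> p \<cdot> h = \<pi>' 0 \<and> q \<cdot> h = \<pi>' 1"
      using l assms(6) unfolding is_pullback_def by metis
    have "(\<forall>i \<in> Obj cospan_shape. ?\<pi> i \<cdot> h = \<pi>' i) \<longleftrightarrow> p \<cdot> h = \<pi>' 0 \<and> q \<cdot> h = \<pi>' 1"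
      if "h \<in> hom C L' L" for h
    proof -
      have "(f \<cdot> p) \<cdot> h = f \<cdot> (p \<cdot> h)"
        using that assms by (intro Comp_assoc_arr) (auto simp: hom_def)
      then show ?thesis using c by (auto simp: cospan_shape_def)
    qed
    then show ?thesis using ex by (smt (verit))
  qed
  then show "limit_cone cospan_shape C (cospan_diagram C f g) L ?\<pi>"
    using l assms Dom_in_Obj unfolding limit_cone_def cone_cospan_iff[OF assms(1-3)]
    by (auto simp: hom_def is_pullback_def)
next
  assume r: "limit_cone cospan_shape C (cospan_diagram C f g) L ?\<pi>"
  then have sq: "f \<cdot> p = g \<cdot> q"
    unfolding limit_cone_def cone_cospan_iff[OF assms(1-3)] by simp
  have "\<exists>!h. h \<in> hom C X L \<and> p \<cdot> h = a \<and> q \<cdot> h = b"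
    if a: "a \<in> hom C X (Dom C f)" and b: "b \<in> hom C X (Dom C g)" and ab: "f \<cdot> a = g \<cdot> b" for X a b
  proof -
    let ?c = "\<lambda>i::nat. if i = 0 then a else if i = 1 then b else f \<cdot> a"
    have "cone cospan_shape C (cospan_diagram C f g) X ?c"
      unfolding cone_cospan_iff[OF assms(1-3)] using a b ab Dom_in_Obj by (auto simp: hom_def)
    then have ex: "\<exists>!h. h \<in> hom C X L \<and> (\<forall>i \<in> Obj cospan_shape. ?\<pi> i \<cdot> h = ?c i)"
      using r unfolding limit_cone_def by blast
    have "(\<forall>i \<in> Obj cospan_shape. ?\<pi> i \<cdot> h = ?c i) \<longleftrightarrow> p \<cdot> h = a \<and> q \<cdot> h = b"
      if "h \<in> hom C X L" for h
    proof -
      have "(f \<cdot> p) \<cdot> h = f \<cdot> (p \<cdot> h)"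
        using that assms by (intro Comp_assoc_arr) (auto simp: hom_def)
      then show ?thesis by (auto simp: cospan_shape_def)
    qed
    then show ?thesis using ex by (smt (verit))
  qed
  then show ?l using assms sq unfolding is_pullback_def by auto
qed

lemma products_exist:
  assumes "has_finite_limits C" "A \<in> Obj C" "B \<in> Obj C"
  obtains W p q where "is_product C A B W p q"
proof -
  obtain L \<pi> where L: "limit_cone pair_shape C (pair_diagram C A B) L \<pi>"
    using assms(1) finite_pair_shape is_functor_pair_diagram[OF assms(2,3)]
    unfolding has_finite_limits_def by blast
  then have "limit_cone pair_shape C (pair_diagram C A B) L (\<lambda>i. if i = 0 then \<pi> 0 else \<pi> 1)"
    unfolding limit_cone_def cone_pair_iff[OF assms(2,3)] by (auto simp: pair_shape_def)
  then show ?thesis using that is_product_iff_limit_cone[OF assms(2,3)] by blast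
qed

lemma pullbacks_exist:
  assumes "has_finite_limits C" "f \<in> Arr C" "g \<in> Arr C" "Cod C f = Cod C g"
  obtains p q where "is_pullback C f g p q"
proof -
  obtain L \<pi> where L: "limit_cone cospan_shape C (cospan_diagram C f g) L \<pi>"
    using assms(1) finite_cospan_shape is_functor_cospan_diagram[OF assms(2-4)]
    unfolding has_finite_limits_def by blast
  then have c: "\<pi> 0 \<in> hom C L (Dom C f) \<and> \<pi> 1 \<in> hom C L (Dom C g) \<and> f \<cdot> \<pi> 0 = \<pi> 2 \<and> g \<cdot> \<pi> 1 = \<pi> 2"
    unfolding limit_cone_def cone_cospan_iff[OF assms(2-4)] by blast
  from L c have "limit_cone cospan_shape C (cospan_diagram C f g) L
      (\<lambda>i. if i = 0 then \<pi> 0 else if i = 1 then \<pi> 1 else f \<cdot> \<pi> 0)"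
    unfolding limit_cone_def cone_cospan_iff[OF assms(2-4)] by (auto simp: cospan_shape_def)
  then show ?thesis
    using that is_pullback_iff_limit_cone[OF assms(2-4), of "\<pi> 0" "\<pi> 1" L] c by (auto simp: hom_def)
qed

lemma monic_iff_kernel_pair:
  assumes "f \<in> Arr C"
  shows "monic C f \<longleftrightarrow> is_pullback C f f (Id C (Dom C f)) (Id C (Dom C f))"
proof -
  have X: "Dom C f \<in> Obj C" using assms by (rule Dom_in_Obj)
  have "(\<exists>!h. h \<in> hom C X (Dom C f) \<and> Id C (Dom C f) \<cdot> h = a \<and> Id C (Dom C f) \<cdot> h = b) \<longleftrightarrow> a = b"
    if "a \<in> hom C X (Dom C f)" "b \<in> hom C X (Dom C f)" for X a b
  proof -
    have "Id C (Dom C f) \<cdot> h = h" if "h \<in> hom C X (Dom C f)" for h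
      using that by (rule Id_Comp)
    then show ?thesis using that by metis
  qed
  then have "(\<forall>X. \<forall>a \<in> hom C X (Dom C f). \<forall>b \<in> hom C X (Dom C f). f \<cdot> a = f \<cdot> b \<longrightarrow> a = b) \<longleftrightarrow>
    (\<forall>X. \<forall>a \<in> hom C X (Dom C f). \<forall>b \<in> hom C X (Dom C f). f \<cdot> a = f \<cdot> b \<longrightarrow>
      (\<exists>!h. h \<in> hom C X (Dom C f) \<and> Id C (Dom C f) \<cdot> h = a \<and> Id C (Dom C f) \<cdot> h = b))"
    by (intro all_cong1 ball_cong refl) simp
  then show ?thesis using assms X unfolding monic_def is_pullback_def by simp
qed

lemma product_iso_fst:
  assumes W: "is_product C A B W p q" and i: "inverse_arrows C i j" "Dom C i = A"
  shows "is_product C (Cod C i) B W (i \<cdot> p) q"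
  unfolding is_product_def
proof (intro conjI allI ballI)
  note i = i[unfolded inverse_arrows_def]
  have p: "p \<in> Arr C" "Dom C p = W" "Cod C p = A" using W by (auto simp: is_product_def hom_def)
  show "W \<in> Obj C" "q \<in> hom C W B" using W by (auto simp: is_product_def)
  show "i \<cdot> p \<in> hom C W (Cod C i)" using i p by (simp add: hom_def)
  fix X f g assume f: "f \<in> hom C X (Cod C i)" and g: "g \<in> hom C X B"
  have "j \<cdot> f \<in> hom C X A" using f i by (simp add: hom_def)
  then have ex: "\<exists>!h. h \<in> hom C X W \<and> p \<cdot> h = j \<cdot> f \<and> q \<cdot> h = g"
    using W g unfolding is_product_def by blast
  have "(i \<cdot> p) \<cdot> h = f \<longleftrightarrow> p \<cdot> h = j \<cdot> f" if h: "h \<in> hom C X W" for h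
  proof -
    have "(i \<cdot> p) \<cdot> h = i \<cdot> (p \<cdot> h)"
      by (rule Comp_assoc_arr) (use i p h in \<open>auto simp: hom_def\<close>)
    moreover have "i \<cdot> (j \<cdot> f) = f"
      using i f Comp_assoc_arr[of f j i] by (auto simp: hom_def)
    moreover have "j \<cdot> (i \<cdot> (p \<cdot> h)) = p \<cdot> h"
      using i p h Comp_assoc_arr[of "p \<cdot> h" i j] by (auto simp: hom_def)
    ultimately show ?thesis by metis
  qed
  then show "\<exists>!h. h \<in> hom C X W \<and> (i \<cdot> p) \<cdot> h = f \<and> q \<cdot> h = g" using ex by (smt (verit))
qed

end

section \<open>Subcategories closed under the finite limits of the larger category\<close>

lemma comp_id_functor [simp]: "id_functor \<circ>\<^sub>F G = G"
  by (simp add: comp_functor_def id_functor_def comp_def)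

lemma id_functor_simps [simp]: "obj_map id_functor X = X" "arr_map id_functor f = f"
  by (simp_all add: id_functor_def)

lemma arr_map_id_functor_comp [simp]: "arr_map id_functor \<circ> \<pi> = \<pi>"
  by (simp add: id_functor_def comp_def)

text \<open>This locale is used twice, for \<open>N\<close> in \<open>M\<close> and for the strongly Cantorian objects in \<open>N\<close>. The
  simplification rules carry all domains, identities and composites over to the larger category.\<close>

locale lex_subcategory = C: category C + D: category D
  for C D :: "('o, 'm) category" +
  assumes subcategory: "subcategory C D"
    and has_limits: "has_finite_limits C"
    and preserves: "preserves_finite_limits C D id_functor"
begin

lemma Arr_D [simp]: "f \<in> Arr C \<Longrightarrow> f \<in> Arr D"
  using subcategory by (auto simp: subcategory_def)

lemma Obj_D [simp]: "X \<in> Obj C \<Longrightarrow> X \<in> Obj D"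
  using subcategory by (auto simp: subcategory_def)

lemma Dom_C [simp]: "f \<in> Arr C \<Longrightarrow> Dom C f = Dom D f"
  using subcategory by (auto simp: subcategory_def)

lemma Cod_C [simp]: "f \<in> Arr C \<Longrightarrow> Cod C f = Cod D f"
  using subcategory by (auto simp: subcategory_def)

lemma Id_C [simp]: "X \<in> Obj C \<Longrightarrow> Id C X = Id D X"
  using subcategory by (auto simp: subcategory_def)

lemma Comp_C [simp]:
  assumes "f \<in> Arr C" "g \<in> Arr C" "Cod D f = Dom D g"
  shows "g \<cdot>\<^bsub>C\<^esub> f = g \<cdot>\<^bsub>D\<^esub> f"
proof -
  have "f \<in> hom C (Dom C f) (Cod C f)" "g \<in> hom C (Cod C f) (Cod C g)"
    using assms by (auto simp: hom_def)
  then show ?thesis using subcategory by (auto simp: subcategory_def)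
qed

lemma Comp_D_in_C:
  assumes "f \<in> Arr C" "g \<in> Arr C" "Cod D f = Dom D g"
  shows "g \<cdot>\<^bsub>D\<^esub> f \<in> Arr C"
  using C.Comp_arr[of f g] assms by simp

lemma hom_C_iff: "f \<in> hom C X Y \<longleftrightarrow> f \<in> Arr C \<and> Dom D f = X \<and> Cod D f = Y"
  by (auto simp: hom_def)

lemma Dom_D_in_C: "f \<in> Arr C \<Longrightarrow> Dom D f \<in> Obj C"
  using C.Dom_in_Obj by fastforce

lemma Cod_D_in_C: "f \<in> Arr C \<Longrightarrow> Cod D f \<in> Obj C"
  using C.Cod_in_Obj by fastforce

lemma inverse_arrows_D:
  assumes "inverse_arrows C f g"
  shows "inverse_arrows D f g"
  using assms by (auto simp: inverse_arrows_def Dom_D_in_C Cod_D_in_C)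

lemma limit_cone_D:
  fixes J :: "(nat, nat) category"
  assumes "finite_category J" "is_functor J C G" "limit_cone J C G L \<pi>"
  shows "limit_cone J D G L \<pi>"
  using preserves[unfolded preserves_finite_limits_def, rule_format, of J G L \<pi>] assms by simp

lemma product_D:
  assumes "is_product C A B W p q"
  shows "is_product D A B W p q"
proof -
  have AB: "A \<in> Obj C" "B \<in> Obj C"
    using assms C.Cod_in_Obj by (auto simp: is_product_def hom_def)
  have "limit_cone pair_shape C (pair_diagram C A B) W (\<lambda>i. if i = 0 then p else q)"
    using assms AB C.is_product_iff_limit_cone by blast
  then have "limit_cone pair_shape D (pair_diagram C A B) W (\<lambda>i. if i = 0 then p else q)"
    using limit_cone_D finite_pair_shape C.is_functor_pair_diagram AB by blast
  moreover have "pair_diagram C A B = pair_diagram D A B"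
    using AB by (auto simp: pair_diagram_def)
  ultimately show ?thesis using D.is_product_iff_limit_cone AB by simp
qed

lemma pullback_D:
  assumes "is_pullback C f g p q"
  shows "is_pullback D f g p q"
proof -
  have ar: "f \<in> Arr C" "g \<in> Arr C" "p \<in> Arr C" "q \<in> Arr C"
    and ends: "Cod D f = Cod D g" "Dom D p = Dom D q" "Cod D p = Dom D f" "Cod D q = Dom D g"
    using assms by (auto simp: is_pullback_def)
  let ?\<pi> = "\<lambda>i::nat. if i = 0 then p else if i = 1 then q else f \<cdot>\<^bsub>D\<^esub> p"
  have "limit_cone cospan_shape C (cospan_diagram C f g) (Dom D p) ?\<pi>"
    using assms ar ends C.is_pullback_iff_limit_cone[of f g p q "Dom D p"]
    unfolding Comp_C[OF ar(3,1) ends(3)] by simp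
  then have "limit_cone cospan_shape D (cospan_diagram C f g) (Dom D p) ?\<pi>"
    using limit_cone_D finite_cospan_shape C.is_functor_cospan_diagram ar ends by simp
  moreover have "cospan_diagram C f g = cospan_diagram D f g"
    using ar by (auto simp: cospan_diagram_def Let_def Dom_D_in_C Cod_D_in_C fun_eq_iff)
  moreover have "is_pullback D f g p q \<longleftrightarrow>
      limit_cone cospan_shape D (cospan_diagram D f g) (Dom D p) ?\<pi>"
    by (rule D.is_pullback_iff_limit_cone) (use ar ends in auto)
  ultimately show ?thesis by metis
qed

text \<open>A mono is an arrow whose kernel pair consists of identities, so it is a finite-limit notion.\<close>

lemma monic_D:
  assumes "monic C f"
  shows "monic D f"
proof -
  have f: "f \<in> Arr C" using assms by (simp add: monic_def)
  then have "is_pullback C f f (Id D (Dom D f)) (Id D (Dom D f))"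
    using assms C.monic_iff_kernel_pair[of f] Dom_D_in_C by simp
  from pullback_D[OF this] show ?thesis using D.monic_iff_kernel_pair[of f] f by simp
qed

lemma monic_C:
  assumes "f \<in> Arr C" "monic D f"
  shows "monic C f"
  using assms unfolding monic_def by (auto simp: hom_C_iff) (auto simp: hom_def)

end

section \<open>Reflecting arrows and strongly Cantorian objects\<close>

context IMLU_category
begin

sublocale NM: lex_subcategory N M
proof -
  have sub: "subcategory N M" "heyting_functor N M id_functor"
    using heyting_sub by (auto simp: heyting_subcategory_def)
  show "lex_subcategory N M"
    unfolding lex_subcategory_def lex_subcategory_axioms_def
    using sub heyting_functor.preserves_limits[OF sub(2)]
      heyting_category.finite_limits[OF heyting_N] by (auto simp: subcategory_def)
qed

lemma inverse_arrows_N: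
  assumes f: "f \<in> Arr N" and g: "inverse_arrows M f g"
  shows "inverse_arrows N f g"
proof -
  have "is_iso N f"
    using conservative_sub f g unfolding conservative_def is_iso_iff_inverse_arrows by auto
  then obtain g' where g': "inverse_arrows N f g'" by (auto simp: is_iso_iff_inverse_arrows)
  have "g' = g"
    using NM.inverse_arrows_D[OF g'] NM.D.left_inverse_of_iso[OF g]
    by (auto simp: inverse_arrows_def)
  then show ?thesis using g' by simp
qed

text \<open>In the pullback of \<open>g\<close> along \<open>f\<close>, the projection \<open>p\<close> has the section \<open>s\<close> induced by
  \<open>f \<cdot> id = g \<cdot> a\<close>. As \<open>g\<close> is monic, \<open>s\<close> is a two-sided inverse of \<open>p\<close>, and conservativity puts it
  into \<open>N\<close>. Now \<open>a\<close> is \<open>s\<close> followed by the other projection \<open>q\<close>.\<close>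

lemma factor_in_N:
  assumes f: "f \<in> Arr N" and g: "g \<in> Arr N" "monic M g"
    and a: "a \<in> Arr M" "Cod M a = Dom M g" and fga: "g \<cdot>\<^bsub>M\<^esub> a = f"
  shows "a \<in> Arr N"
proof -
  have Dom_a: "Dom M a = Dom M f" and cod: "Cod M f = Cod M g"
    using a g(1) NM.D.Dom_Comp[of a g] NM.D.Cod_Comp[of a g] fga by auto
  obtain p q where pbN: "is_pullback N f g p q"
    by (rule NM.C.pullbacks_exist[OF NM.has_limits f g(1)]) (use cod f g in auto)
  then have pN: "p \<in> Arr N" and qN: "q \<in> Arr N" by (simp_all add: is_pullback_def)
  have pb: "is_pullback M f g p q" using pbN by (rule NM.pullback_D)
  have dc: "Dom M p = Dom M q" "Cod M p = Dom M f" "Cod M q = Dom M g"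
    and sq: "f \<cdot>\<^bsub>M\<^esub> p = g \<cdot>\<^bsub>M\<^esub> q"
    using pb by (auto simp: is_pullback_def)
  have objs: "Dom M f \<in> Obj M" "Dom M q \<in> Obj M"
    using f qN by (auto intro: NM.D.Dom_in_Obj)
  have univ: "\<exists>!h. h \<in> hom M X (Dom M p) \<and> p \<cdot>\<^bsub>M\<^esub> h = x \<and> q \<cdot>\<^bsub>M\<^esub> h = y"
    if "x \<in> hom M X (Dom M f)" "y \<in> hom M X (Dom M g)" "f \<cdot>\<^bsub>M\<^esub> x = g \<cdot>\<^bsub>M\<^esub> y" for X x y
    using pb that unfolding is_pullback_def by blast
  have "\<exists>!h. h \<in> hom M (Dom M f) (Dom M p) \<and> p \<cdot>\<^bsub>M\<^esub> h = Id M (Dom M f) \<and> q \<cdot>\<^bsub>M\<^esub> h = a"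
    by (rule univ) (use f a fga Dom_a objs in \<open>auto simp: hom_def\<close>)
  then obtain s where s: "s \<in> Arr M" "Dom M s = Dom M f" "Cod M s = Dom M p"
    and ps: "p \<cdot>\<^bsub>M\<^esub> s = Id M (Dom M f)" and qs: "q \<cdot>\<^bsub>M\<^esub> s = a"
    by (auto simp: hom_def)
  have ap: "a \<cdot>\<^bsub>M\<^esub> p = q"
  proof -
    have "g \<cdot>\<^bsub>M\<^esub> (a \<cdot>\<^bsub>M\<^esub> p) = (g \<cdot>\<^bsub>M\<^esub> a) \<cdot>\<^bsub>M\<^esub> p"
      using g a pN dc Dom_a by (intro NM.D.Comp_assoc_arr[symmetric]) auto
    then have "g \<cdot>\<^bsub>M\<^esub> (a \<cdot>\<^bsub>M\<^esub> p) = g \<cdot>\<^bsub>M\<^esub> q" using fga sq by simp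
    moreover have "a \<cdot>\<^bsub>M\<^esub> p \<in> hom M (Dom M q) (Dom M g)" "q \<in> hom M (Dom M q) (Dom M g)"
      using a pN qN dc Dom_a by (auto simp: hom_def)
    ultimately show ?thesis using g(2) unfolding monic_def by blast
  qed
  have "\<exists>!h. h \<in> hom M (Dom M p) (Dom M p) \<and> p \<cdot>\<^bsub>M\<^esub> h = p \<and> q \<cdot>\<^bsub>M\<^esub> h = q"
    by (rule univ) (use pN qN dc sq in \<open>auto simp: hom_def\<close>)
  moreover have "p \<cdot>\<^bsub>M\<^esub> (s \<cdot>\<^bsub>M\<^esub> p) = p" "q \<cdot>\<^bsub>M\<^esub> (s \<cdot>\<^bsub>M\<^esub> p) = q"
    using NM.D.Comp_assoc_arr[of p s p] NM.D.Comp_assoc_arr[of p s q] ps qs ap pN qN s dc objs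
    by auto
  moreover have "s \<cdot>\<^bsub>M\<^esub> p \<in> hom M (Dom M p) (Dom M p)" "Id M (Dom M p) \<in> hom M (Dom M p) (Dom M p)"
    using pN s dc objs by (auto simp: hom_def)
  moreover have "p \<cdot>\<^bsub>M\<^esub> Id M (Dom M p) = p" "q \<cdot>\<^bsub>M\<^esub> Id M (Dom M p) = q"
    using pN qN dc by auto
  ultimately have "s \<cdot>\<^bsub>M\<^esub> p = Id M (Dom M p)" by blast
  then have "inverse_arrows M p s"
    using pN s ps dc by (auto simp: inverse_arrows_def)
  from inverse_arrows_N[OF pN this] have "s \<in> Arr N" by (simp add: inverse_arrows_def)
  then show ?thesis using NM.Comp_D_in_C[of s q] qN s dc qs by simp
qed

sublocale TM: is_functor M M T by (rule T_endo_M)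

lemma T_arr [simp]:
  assumes "f \<in> Arr M"
  shows "arr_map T f \<in> Arr M" "Dom M (arr_map T f) = obj_map T (Dom M f)"
    "Cod M (arr_map T f) = obj_map T (Cod M f)"
  using TM.arr_map_in_hom[OF NM.D.arr_in_hom[OF assms]] by (auto simp: hom_def)

lemma T_arr_N [simp]: "f \<in> Arr N \<Longrightarrow> arr_map T f \<in> Arr N"
  using is_functor.arr_map_in_hom[OF T_endo_N NM.C.arr_in_hom] by (auto simp: hom_def)

lemma T_Obj_N [simp]: "X \<in> Obj N \<Longrightarrow> obj_map T X \<in> Obj N"
  using is_functor.obj_map_in_Obj[OF T_endo_N] .

lemma P_Obj_N [simp]: "X \<in> Obj N \<Longrightarrow> obj_map P X \<in> Obj N"
  using is_functor.obj_map_in_Obj[OF P_endo] .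

lemma iota_arr [simp]:
  assumes "X \<in> Obj M"
  shows "\<iota> X \<in> Arr M" "Dom M (\<iota> X) = X" "Cod M (\<iota> X) = obj_map T X"
  using iota_iso assms by (auto simp: natural_iso_def hom_def)

definition iota_inv :: "'o \<Rightarrow> 'm" where
  "iota_inv X = (SOME g. inverse_arrows M (\<iota> X) g)"

lemma inverse_arrows_iota: "X \<in> Obj M \<Longrightarrow> inverse_arrows M (\<iota> X) (iota_inv X)"
  using iota_iso unfolding iota_inv_def natural_iso_def is_iso_iff_inverse_arrows
  by (metis someI_ex)

lemma iota_inv_arr [simp]:
  assumes "X \<in> Obj M"
  shows "iota_inv X \<in> Arr M" "Dom M (iota_inv X) = obj_map T X" "Cod M (iota_inv X) = X"
    "iota_inv X \<cdot>\<^bsub>M\<^esub> \<iota> X = Id M X" "\<iota> X \<cdot>\<^bsub>M\<^esub> iota_inv X = Id M (obj_map T X)"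
  using inverse_arrows_iota[OF assms] assms by (auto simp: inverse_arrows_def)

lemma iota_inv_iota_Comp [simp]:
  assumes "f \<in> Arr M" "Cod M f = X"
  shows "iota_inv X \<cdot>\<^bsub>M\<^esub> (\<iota> X \<cdot>\<^bsub>M\<^esub> f) = f"
  using assms NM.D.Comp_assoc_arr[of f "\<iota> X" "iota_inv X"] NM.D.Cod_in_Obj by auto

lemma iota_iota_inv_Comp [simp]:
  assumes "f \<in> Arr M" "X \<in> Obj M" "Cod M f = obj_map T X"
  shows "\<iota> X \<cdot>\<^bsub>M\<^esub> (iota_inv X \<cdot>\<^bsub>M\<^esub> f) = f"
  using assms NM.D.Comp_assoc_arr[of f "iota_inv X" "\<iota> X"] by auto

lemma iota_natural:
  assumes "f \<in> Arr M"
  shows "arr_map T f \<cdot>\<^bsub>M\<^esub> \<iota> (Dom M f) = \<iota> (Cod M f) \<cdot>\<^bsub>M\<^esub> f"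
  using iota_iso assms NM.D.arr_in_hom[OF assms] unfolding natural_iso_def by simp

lemma iota_inv_natural:
  assumes f: "f \<in> Arr M"
  shows "iota_inv (Cod M f) \<cdot>\<^bsub>M\<^esub> arr_map T f = f \<cdot>\<^bsub>M\<^esub> iota_inv (Dom M f)"
proof -
  have X: "Dom M f \<in> Obj M" and Y: "Cod M f \<in> Obj M"
    using f by (auto intro: NM.D.Dom_in_Obj NM.D.Cod_in_Obj)
  have "\<iota> (Cod M f) \<cdot>\<^bsub>M\<^esub> (f \<cdot>\<^bsub>M\<^esub> iota_inv (Dom M f))
      = (\<iota> (Cod M f) \<cdot>\<^bsub>M\<^esub> f) \<cdot>\<^bsub>M\<^esub> iota_inv (Dom M f)"
    by (rule NM.D.Comp_assoc_arr[symmetric]) (use f X Y in auto)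
  also have "\<dots> = (arr_map T f \<cdot>\<^bsub>M\<^esub> \<iota> (Dom M f)) \<cdot>\<^bsub>M\<^esub> iota_inv (Dom M f)"
    by (simp add: iota_natural[OF f])
  also have "\<dots> = arr_map T f \<cdot>\<^bsub>M\<^esub> (\<iota> (Dom M f) \<cdot>\<^bsub>M\<^esub> iota_inv (Dom M f))"
    by (rule NM.D.Comp_assoc_arr) (use f X Y in auto)
  also have "\<dots> = arr_map T f" using f X by simp
  finally have "arr_map T f = \<iota> (Cod M f) \<cdot>\<^bsub>M\<^esub> (f \<cdot>\<^bsub>M\<^esub> iota_inv (Dom M f))" by simp
  then show ?thesis using f X Y by simp
qed

lemma T_monic:
  assumes f: "monic M f"
  shows "monic M (arr_map T f)"
  unfolding monic_def
proof (intro conjI allI ballI impI)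
  have fa: "f \<in> Arr M" using f by (simp add: monic_def)
  then have X: "Dom M f \<in> Obj M" and Y: "Cod M f \<in> Obj M"
    by (auto intro: NM.D.Dom_in_Obj NM.D.Cod_in_Obj)
  show "arr_map T f \<in> Arr M" using fa by simp
  fix Z a b
  assume a: "a \<in> hom M Z (Dom M (arr_map T f))" and b: "b \<in> hom M Z (Dom M (arr_map T f))"
    and ab: "arr_map T f \<cdot>\<^bsub>M\<^esub> a = arr_map T f \<cdot>\<^bsub>M\<^esub> b"
  have key: "f \<cdot>\<^bsub>M\<^esub> (iota_inv (Dom M f) \<cdot>\<^bsub>M\<^esub> x) = iota_inv (Cod M f) \<cdot>\<^bsub>M\<^esub> (arr_map T f \<cdot>\<^bsub>M\<^esub> x)"
    if "x \<in> hom M Z (Dom M (arr_map T f))" for x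
    using that fa X Y NM.D.Comp_assoc_arr[of x "iota_inv (Dom M f)" f]
      NM.D.Comp_assoc_arr[of x "arr_map T f" "iota_inv (Cod M f)"] iota_inv_natural[OF fa]
    by (auto simp: hom_def)
  have "iota_inv (Dom M f) \<cdot>\<^bsub>M\<^esub> a = iota_inv (Dom M f) \<cdot>\<^bsub>M\<^esub> b"
    using f key[OF a] key[OF b] ab a b fa X unfolding monic_def
    by (auto simp: hom_def)
  then have "\<iota> (Dom M f) \<cdot>\<^bsub>M\<^esub> (iota_inv (Dom M f) \<cdot>\<^bsub>M\<^esub> a)
      = \<iota> (Dom M f) \<cdot>\<^bsub>M\<^esub> (iota_inv (Dom M f) \<cdot>\<^bsub>M\<^esub> b)" by simp
  then show "a = b" using a b fa X by (simp add: hom_def)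
qed

lemma strongly_Cantorian_iff:
  "strongly_Cantorian N \<iota> X \<longleftrightarrow> X \<in> Obj N \<and> \<iota> X \<in> Arr N"
  using inverse_arrows_N[OF _ inverse_arrows_iota, of X]
  by (auto simp: strongly_Cantorian_def is_iso_iff_inverse_arrows inverse_arrows_def)

lemma strongly_Cantorian_if_iota_inv:
  assumes "X \<in> Obj N" "iota_inv X \<in> Arr N"
  shows "strongly_Cantorian N \<iota> X"
  using inverse_arrows_N[OF assms(2) inverse_arrows_sym[OF inverse_arrows_iota]] assms
  by (auto simp: strongly_Cantorian_iff inverse_arrows_def)

lemma inverse_arrows_iota_N:
  assumes "strongly_Cantorian N \<iota> X"
  shows "inverse_arrows N (\<iota> X) (iota_inv X)"
  using assms inverse_arrows_N[OF _ inverse_arrows_iota, of X] by (auto simp: strongly_Cantorian_iff)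

lemma iota_inv_in_N:
  assumes "strongly_Cantorian N \<iota> X"
  shows "iota_inv X \<in> Arr N"
  using inverse_arrows_iota_N[OF assms] by (simp add: inverse_arrows_def)

text \<open>Naturality displays \<open>\<iota>\<close> at the domain as the factor of an arrow of \<open>N\<close> through the mono \<open>T f\<close>
  of \<open>N\<close>.\<close>

lemma strongly_Cantorian_subobject:
  assumes f: "f \<in> Arr N" "monic M f" and Y: "strongly_Cantorian N \<iota> (Cod M f)"
  shows "strongly_Cantorian N \<iota> (Dom M f)"
proof -
  have objs: "Dom M f \<in> Obj N" "Cod M f \<in> Obj N"
    using f NM.Dom_D_in_C NM.Cod_D_in_C by auto
  have "\<iota> (Cod M f) \<cdot>\<^bsub>M\<^esub> f \<in> Arr N"
    using NM.Comp_D_in_C[of f "\<iota> (Cod M f)"] f Y objs by (auto simp: strongly_Cantorian_iff)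
  then have "\<iota> (Dom M f) \<in> Arr N"
    by (rule factor_in_N[of _ "arr_map T f"])
      (use f objs T_monic iota_natural[of f] in auto)
  then show ?thesis using objs by (simp add: strongly_Cantorian_iff)
qed

text \<open>Naturality of \<open>\<iota>\<close> at the arrow \<open>\<iota> X\<close>, after cancelling \<open>\<iota> X\<close>, gives \<open>\<iota> (T X) = T (\<iota> X)\<close>.\<close>

lemma strongly_Cantorian_T:
  assumes X: "strongly_Cantorian N \<iota> X"
  shows "strongly_Cantorian N \<iota> (obj_map T X)"
proof -
  have i: "\<iota> X \<in> Arr N" "X \<in> Obj N" using X by (auto simp: strongly_Cantorian_iff)
  have "arr_map T (\<iota> X) \<cdot>\<^bsub>M\<^esub> \<iota> X = \<iota> (obj_map T X) \<cdot>\<^bsub>M\<^esub> \<iota> X"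
    using iota_natural[of "\<iota> X"] i by simp
  then have "(arr_map T (\<iota> X) \<cdot>\<^bsub>M\<^esub> \<iota> X) \<cdot>\<^bsub>M\<^esub> iota_inv X = (\<iota> (obj_map T X) \<cdot>\<^bsub>M\<^esub> \<iota> X) \<cdot>\<^bsub>M\<^esub> iota_inv X"
    by simp
  then have "arr_map T (\<iota> X) = \<iota> (obj_map T X)"
    using i NM.D.Comp_assoc_arr[of "iota_inv X" "\<iota> X" "arr_map T (\<iota> X)"]
      NM.D.Comp_assoc_arr[of "iota_inv X" "\<iota> X" "\<iota> (obj_map T X)"] by simp
  then show ?thesis using i T_arr_N[of "\<iota> X"] by (simp add: strongly_Cantorian_iff)
qed

end

section \<open>Finite limits of strongly Cantorian objects\<close>

text \<open>This and the next lemma move the limit property along the comparison isomorphism, so that any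
  limit in \<open>SCan\<close> can be traded for one computed in \<open>N\<close>.\<close>

lemma limit_cone_comparison:
  assumes "category C" and L: "limit_cone J C G L \<pi>" and L': "limit_cone J C G L' \<pi>'"
  obtains u v where "inverse_arrows C u v" "u \<in> hom C L' L" "\<And>i. i \<in> Obj J \<Longrightarrow> \<pi> i \<cdot>\<^bsub>C\<^esub> u = \<pi>' i"
proof -
  interpret category C by fact
  have c: "cone J C G L \<pi>" "cone J C G L' \<pi>'" using L L' by (auto simp: limit_cone_def)
  have ob: "L \<in> Obj C" "L' \<in> Obj C" using c by (auto simp: cone_def)
  obtain u where u: "u \<in> hom C L' L" "\<forall>i \<in> Obj J. \<pi> i \<cdot>\<^bsub>C\<^esub> u = \<pi>' i"
    using L c(2) unfolding limit_cone_def by blast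
  obtain v where v: "v \<in> hom C L L'" "\<forall>i \<in> Obj J. \<pi>' i \<cdot>\<^bsub>C\<^esub> v = \<pi> i"
    using L' c(1) unfolding limit_cone_def by blast
  have endo: "h = Id C K" if K: "limit_cone J C G K \<rho>" and h: "h \<in> hom C K K"
    and inv: "\<forall>i \<in> Obj J. \<rho> i \<cdot>\<^bsub>C\<^esub> h = \<rho> i" for K \<rho> h
  proof -
    have "cone J C G K \<rho>" using K by (simp add: limit_cone_def)
    then have "\<exists>!h. h \<in> hom C K K \<and> (\<forall>i \<in> Obj J. \<rho> i \<cdot>\<^bsub>C\<^esub> h = \<rho> i)"
      and "Id C K \<in> hom C K K" and "\<forall>i \<in> Obj J. \<rho> i \<cdot>\<^bsub>C\<^esub> Id C K = \<rho> i"
      using K Id_in_hom by (auto simp: limit_cone_def cone_def intro: Comp_Id)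
    then show ?thesis using h inv by blast
  qed
  have \<pi>: "\<pi> i \<in> hom C L (obj_map G i)" "\<pi>' i \<in> hom C L' (obj_map G i)" if "i \<in> Obj J" for i
    using c that by (auto simp: cone_def)
  have "u \<cdot>\<^bsub>C\<^esub> v = Id C L"
  proof (rule endo[OF L Comp_in_hom[OF v(1) u(1)]])
    show "\<forall>i \<in> Obj J. \<pi> i \<cdot>\<^bsub>C\<^esub> (u \<cdot>\<^bsub>C\<^esub> v) = \<pi> i"
      using Comp_assoc[OF v(1) u(1) \<pi>(1)] u(2) v(2) by simp
  qed
  moreover have "v \<cdot>\<^bsub>C\<^esub> u = Id C L'"
  proof (rule endo[OF L' Comp_in_hom[OF u(1) v(1)]])
    show "\<forall>i \<in> Obj J. \<pi>' i \<cdot>\<^bsub>C\<^esub> (v \<cdot>\<^bsub>C\<^esub> u) = \<pi>' i"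
      using Comp_assoc[OF u(1) v(1) \<pi>(2)] u(2) v(2) by simp
  qed
  ultimately have "inverse_arrows C u v"
    using u v by (auto simp: inverse_arrows_def hom_def)
  then show ?thesis using that u by blast
qed

lemma limit_cone_iso:
  assumes G: "is_functor J C G" and L: "limit_cone J C G L \<pi>"
    and uv: "inverse_arrows C u v" "u \<in> hom C L' L"
    and \<pi>': "\<And>i. i \<in> Obj J \<Longrightarrow> \<pi> i \<cdot>\<^bsub>C\<^esub> u = \<pi>' i"
  shows "limit_cone J C G L' \<pi>'"
  unfolding limit_cone_def
proof (intro conjI allI impI)
  interpret G: is_functor J C G by fact
  note uv' = uv[unfolded inverse_arrows_def hom_def]
  have v: "v \<in> hom C L L'" "u \<cdot>\<^bsub>C\<^esub> v = Id C L" "v \<cdot>\<^bsub>C\<^esub> u = Id C L'"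
    using uv' by (auto simp: hom_def)
  have \<pi>: "\<pi> i \<in> hom C L (obj_map G i)" if "i \<in> Obj J" for i
    using L that by (auto simp: limit_cone_def cone_def)
  show "cone J C G L' \<pi>'"
    unfolding cone_def
  proof (intro conjI allI ballI)
    show "L' \<in> Obj C" using uv(2) G.D.Dom_in_Obj by (auto simp: hom_def)
    show "\<pi>' i \<in> hom C L' (obj_map G i)" if "i \<in> Obj J" for i
      using G.D.Comp_in_hom[OF uv(2) \<pi>[OF that]] \<pi>'[OF that] by simp
    fix i j w assume w: "w \<in> hom J i j"
    then have ij: "i \<in> Obj J" "j \<in> Obj J"
      using G.C.Dom_in_Obj G.C.Cod_in_Obj by (auto simp: hom_def)
    have "arr_map G w \<cdot>\<^bsub>C\<^esub> \<pi>' i = (arr_map G w \<cdot>\<^bsub>C\<^esub> \<pi> i) \<cdot>\<^bsub>C\<^esub> u"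
      using G.D.Comp_assoc[OF uv(2) \<pi>[OF ij(1)] G.arr_map_in_hom[OF w]] \<pi>'[OF ij(1)] by simp
    also have "arr_map G w \<cdot>\<^bsub>C\<^esub> \<pi> i = \<pi> j" using L w by (auto simp: limit_cone_def cone_def)
    finally show "arr_map G w \<cdot>\<^bsub>C\<^esub> \<pi>' i = \<pi>' j" using \<pi>'[OF ij(2)] by simp
  qed
  fix K \<rho> assume "cone J C G K \<rho>"
  then have "\<exists>!h. h \<in> hom C K L \<and> (\<forall>i \<in> Obj J. \<pi> i \<cdot>\<^bsub>C\<^esub> h = \<rho> i)"
    using L by (simp add: limit_cone_def)
  then obtain h where h: "h \<in> hom C K L" "\<forall>i \<in> Obj J. \<pi> i \<cdot>\<^bsub>C\<^esub> h = \<rho> i"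
    and uniq: "\<And>h'. h' \<in> hom C K L \<Longrightarrow> \<forall>i \<in> Obj J. \<pi> i \<cdot>\<^bsub>C\<^esub> h' = \<rho> i \<Longrightarrow> h' = h"
    by blast
  have \<pi>'_Comp: "\<pi>' i \<cdot>\<^bsub>C\<^esub> k = \<pi> i \<cdot>\<^bsub>C\<^esub> (u \<cdot>\<^bsub>C\<^esub> k)" if "i \<in> Obj J" "k \<in> hom C K L'" for i k
    using G.D.Comp_assoc[OF that(2) uv(2) \<pi>[OF that(1)]] \<pi>'[OF that(1)] by simp
  show "\<exists>!k. k \<in> hom C K L' \<and> (\<forall>i \<in> Obj J. \<pi>' i \<cdot>\<^bsub>C\<^esub> k = \<rho> i)"
  proof (rule ex1I[of _ "v \<cdot>\<^bsub>C\<^esub> h"])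
    have vh: "v \<cdot>\<^bsub>C\<^esub> h \<in> hom C K L'" using G.D.Comp_in_hom[OF h(1) v(1)] .
    have "u \<cdot>\<^bsub>C\<^esub> (v \<cdot>\<^bsub>C\<^esub> h) = h"
      using G.D.Comp_assoc[OF h(1) v(1) uv(2)] v(2) G.D.Id_Comp[OF h(1)] by simp
    then show "v \<cdot>\<^bsub>C\<^esub> h \<in> hom C K L' \<and> (\<forall>i \<in> Obj J. \<pi>' i \<cdot>\<^bsub>C\<^esub> (v \<cdot>\<^bsub>C\<^esub> h) = \<rho> i)"
      using vh h \<pi>'_Comp by simp
    fix k assume k: "k \<in> hom C K L' \<and> (\<forall>i \<in> Obj J. \<pi>' i \<cdot>\<^bsub>C\<^esub> k = \<rho> i)"
    have "u \<cdot>\<^bsub>C\<^esub> k = h"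
      by (rule uniq) (use k \<pi>'_Comp G.D.Comp_in_hom[OF _ uv(2)] in auto)
    then show "k = v \<cdot>\<^bsub>C\<^esub> h"
      using G.D.Comp_assoc[OF _ uv(2) v(1), of k K] v(3) G.D.Id_Comp[of k K L'] k by simp
  qed
qed

context IMLU_category
begin

text \<open>The cone \<open>\<rho>\<close> from \<open>T L\<close> has two descriptions: the definition shows that it lies in \<open>N\<close>, and
  naturality rewrites it as \<open>\<pi> i \<cdot> \<iota>\<^sub>L\<inverse>\<close>. The arrow it induces from \<open>T L\<close> to \<open>L\<close> is in \<open>N\<close> by the
  first, and is a left inverse of \<open>\<iota> L\<close> by the second.\<close>

lemma strongly_Cantorian_limit:
  fixes J :: "(nat, nat) category"
  assumes J: "finite_category J" and G: "is_functor J N G" and L: "limit_cone J N G L \<pi>"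
    and sC: "\<And>i. i \<in> Obj J \<Longrightarrow> strongly_Cantorian N \<iota> (obj_map G i)"
  shows "strongly_Cantorian N \<iota> L"
proof -
  interpret G: is_functor J N G by (rule G)
  have LM: "limit_cone J M G L \<pi>" using NM.limit_cone_D[OF J G L] .
  have L_Obj: "L \<in> Obj N" using L by (auto simp: limit_cone_def cone_def)
  have \<pi>: "\<pi> i \<in> Arr N" "Dom M (\<pi> i) = L" "Cod M (\<pi> i) = obj_map G i" if "i \<in> Obj J" for i
    using L that by (auto simp: limit_cone_def cone_def NM.hom_C_iff)
  define \<rho> where "\<rho> i = iota_inv (obj_map G i) \<cdot>\<^bsub>M\<^esub> arr_map T (\<pi> i)" for i
  have \<rho>: "\<rho> i = \<pi> i \<cdot>\<^bsub>M\<^esub> iota_inv L" if "i \<in> Obj J" for i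
    using iota_inv_natural[of "\<pi> i"] \<pi>[OF that] by (simp add: \<rho>_def)
  have \<rho>N: "\<rho> i \<in> Arr N" "Dom M (\<rho> i) = obj_map T L" "Cod M (\<rho> i) = obj_map G i"
    if i: "i \<in> Obj J" for i
    using NM.Comp_D_in_C[of "arr_map T (\<pi> i)" "iota_inv (obj_map G i)"] iota_inv_in_N[OF sC[OF i]]
      \<pi>[OF i] G.obj_map_in_Obj[OF i] by (simp_all add: \<rho>_def)
  have "cone J N G (obj_map T L) \<rho>"
    unfolding cone_def
  proof (intro conjI allI ballI)
    show "obj_map T L \<in> Obj N" using L_Obj by simp
    show "\<rho> i \<in> hom N (obj_map T L) (obj_map G i)" if "i \<in> Obj J" for i
      using \<rho>N[OF that] by (simp add: NM.hom_C_iff)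
    fix i j w assume w: "w \<in> hom J i j"
    then have ij: "i \<in> Obj J" "j \<in> Obj J"
      using G.C.Dom_in_Obj G.C.Cod_in_Obj by (auto simp: hom_def)
    have Gw: "arr_map G w \<in> Arr N" "Dom M (arr_map G w) = obj_map G i" "Cod M (arr_map G w) = obj_map G j"
      using G.arr_map_in_hom[OF w] by (auto simp: NM.hom_C_iff)
    have \<pi>w: "arr_map G w \<cdot>\<^bsub>M\<^esub> \<pi> i = \<pi> j"
      using LM w by (auto simp: limit_cone_def cone_def)
    have "arr_map G w \<cdot>\<^bsub>N\<^esub> \<rho> i = arr_map G w \<cdot>\<^bsub>M\<^esub> (\<pi> i \<cdot>\<^bsub>M\<^esub> iota_inv L)"
      using Gw \<rho>N[OF ij(1)] \<rho>[OF ij(1)] by simp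
    also have "\<dots> = (arr_map G w \<cdot>\<^bsub>M\<^esub> \<pi> i) \<cdot>\<^bsub>M\<^esub> iota_inv L"
      by (rule NM.D.Comp_assoc_arr[symmetric]) (use Gw \<pi>[OF ij(1)] L_Obj in auto)
    also have "\<dots> = \<rho> j" using \<pi>w \<rho>[OF ij(2)] by simp
    finally show "arr_map G w \<cdot>\<^bsub>N\<^esub> \<rho> i = \<rho> j" .
  qed
  then obtain k where k: "k \<in> hom N (obj_map T L) L" "\<forall>i \<in> Obj J. \<pi> i \<cdot>\<^bsub>N\<^esub> k = \<rho> i"
    using L unfolding limit_cone_def by blast
  then have kN: "k \<in> Arr N" "Dom M k = obj_map T L" "Cod M k = L" by (auto simp: NM.hom_C_iff)
  have "cone J M G L \<pi>" using LM by (simp add: limit_cone_def)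
  then have "\<exists>!h. h \<in> hom M L L \<and> (\<forall>i \<in> Obj J. \<pi> i \<cdot>\<^bsub>M\<^esub> h = \<pi> i)"
    using LM by (simp add: limit_cone_def)
  moreover have "Id M L \<in> hom M L L" "\<forall>i \<in> Obj J. \<pi> i \<cdot>\<^bsub>M\<^esub> Id M L = \<pi> i"
    using L_Obj \<pi> by (auto simp: hom_def)
  moreover have "k \<cdot>\<^bsub>M\<^esub> \<iota> L \<in> hom M L L" using kN L_Obj by (auto simp: hom_def)
  moreover have "\<forall>i \<in> Obj J. \<pi> i \<cdot>\<^bsub>M\<^esub> (k \<cdot>\<^bsub>M\<^esub> \<iota> L) = \<pi> i"
  proof
    fix i assume i: "i \<in> Obj J"
    have "\<pi> i \<cdot>\<^bsub>M\<^esub> (k \<cdot>\<^bsub>M\<^esub> \<iota> L) = (\<pi> i \<cdot>\<^bsub>M\<^esub> k) \<cdot>\<^bsub>M\<^esub> \<iota> L"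
      by (rule NM.D.Comp_assoc_arr[symmetric]) (use kN \<pi>[OF i] L_Obj in auto)
    also have "\<pi> i \<cdot>\<^bsub>M\<^esub> k = \<pi> i \<cdot>\<^bsub>M\<^esub> iota_inv L"
      using bspec[OF k(2) i] NM.Comp_C[of k "\<pi> i"] kN \<pi>[OF i] \<rho>[OF i] by simp
    also have "(\<pi> i \<cdot>\<^bsub>M\<^esub> iota_inv L) \<cdot>\<^bsub>M\<^esub> \<iota> L = \<pi> i \<cdot>\<^bsub>M\<^esub> (iota_inv L \<cdot>\<^bsub>M\<^esub> \<iota> L)"
      by (rule NM.D.Comp_assoc_arr) (use \<pi>[OF i] L_Obj in auto)
    also have "\<dots> = \<pi> i" using \<pi>[OF i] L_Obj by simp
    finally show "\<pi> i \<cdot>\<^bsub>M\<^esub> (k \<cdot>\<^bsub>M\<^esub> \<iota> L) = \<pi> i" .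
  qed
  ultimately have "k \<cdot>\<^bsub>M\<^esub> \<iota> L = Id M L" by blast
  then have "k = iota_inv L"
    using NM.D.left_inverse_of_iso[OF inverse_arrows_iota, of L k] kN L_Obj by simp
  then show ?thesis using strongly_Cantorian_if_iota_inv L_Obj kN by simp
qed

lemma SCan_simps [simp]:
  "Obj (SCan N \<iota>) = {X. strongly_Cantorian N \<iota> X}"
  "f \<in> Arr (SCan N \<iota>) \<longleftrightarrow> f \<in> Arr N \<and> strongly_Cantorian N \<iota> (Dom M f) \<and> strongly_Cantorian N \<iota> (Cod M f)"
  "Dom (SCan N \<iota>) = Dom N" "Cod (SCan N \<iota>) = Cod N" "Id (SCan N \<iota>) = Id N"
  "Comp (SCan N \<iota>) = Comp N"
  by (auto simp: SCan_def full_subcategory_on_def strongly_Cantorian_def)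

lemma hom_SCan_iff:
  "f \<in> hom (SCan N \<iota>) X Y \<longleftrightarrow> f \<in> hom N X Y \<and> strongly_Cantorian N \<iota> X \<and> strongly_Cantorian N \<iota> Y"
  by (auto simp: hom_def)

lemma category_SCan: "category (SCan N \<iota>)"
proof
  fix f assume "f \<in> Arr (SCan N \<iota>)"
  then show "Dom (SCan N \<iota>) f \<in> Obj (SCan N \<iota>)" "Cod (SCan N \<iota>) f \<in> Obj (SCan N \<iota>)" by auto
next
  fix X assume "X \<in> Obj (SCan N \<iota>)"
  then show "Id (SCan N \<iota>) X \<in> hom (SCan N \<iota>) X X"
    using NM.C.Id_in_hom by (auto simp: hom_SCan_iff strongly_Cantorian_iff)
qed (auto simp: hom_SCan_iff intro: NM.C.Comp_in_hom NM.C.Comp_Id NM.C.Id_Comp NM.C.Comp_assoc)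

lemma is_functor_SCan_iff:
  "is_functor J (SCan N \<iota>) G \<longleftrightarrow>
    is_functor J N G \<and> (\<forall>i \<in> Obj J. strongly_Cantorian N \<iota> (obj_map G i))" (is "?l \<longleftrightarrow> ?r")
proof
  assume ?l
  then interpret G: is_functor J "SCan N \<iota>" G .
  have "is_functor J N G"
    using G.arr_map_in_hom G.obj_map_in_Obj G.arr_map_Id G.arr_map_Comp
    by unfold_locales (auto simp: hom_SCan_iff strongly_Cantorian_iff)
  then show ?r using G.obj_map_in_Obj by auto
next
  assume r: ?r
  then interpret G: is_functor J N G by simp
  have "i \<in> Obj J \<and> j \<in> Obj J" if "f \<in> hom J i j" for f i j
    using that G.C.Dom_in_Obj G.C.Cod_in_Obj by (auto simp: hom_def)
  then show ?l
    using r category_SCan G.C.category_axioms G.arr_map_in_hom G.arr_map_Id G.arr_map_Comp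
    unfolding is_functor_def is_functor_axioms_def by (auto simp: hom_SCan_iff)
qed

lemma cone_SCan_iff:
  assumes "is_functor J (SCan N \<iota>) G"
  shows "cone J (SCan N \<iota>) G L \<pi> \<longleftrightarrow> cone J N G L \<pi> \<and> strongly_Cantorian N \<iota> L"
  using assms unfolding is_functor_SCan_iff cone_def
  by (auto simp: hom_SCan_iff strongly_Cantorian_iff)

lemma limit_cone_SCan:
  fixes J :: "(nat, nat) category"
  assumes J: "finite_category J" and G: "is_functor J (SCan N \<iota>) G" and L: "limit_cone J N G L \<pi>"
  shows "limit_cone J (SCan N \<iota>) G L \<pi>"
proof -
  have "strongly_Cantorian N \<iota> L"
    using strongly_Cantorian_limit[OF J _ L] G by (auto simp: is_functor_SCan_iff)
  then show ?thesis
    using L unfolding limit_cone_def cone_SCan_iff[OF G] by (auto simp: hom_SCan_iff)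
qed

sublocale SN: lex_subcategory "SCan N \<iota>" N
proof -
  have sub: "subcategory (SCan N \<iota>) N"
    using category_SCan NM.C.category_axioms
    by (auto simp: subcategory_def strongly_Cantorian_iff)
  have lim: "\<exists>L \<pi>. limit_cone J N G L \<pi> \<and> limit_cone J (SCan N \<iota>) G L \<pi>"
    if J: "finite_category J" and G: "is_functor J (SCan N \<iota>) G" for J :: "(nat, nat) category" and G
  proof -
    obtain L \<pi> where "limit_cone J N G L \<pi>"
      using NM.has_limits J G unfolding has_finite_limits_def is_functor_SCan_iff by blast
    then show ?thesis using limit_cone_SCan[OF J G] by blast
  qed
  have "limit_cone J N G L \<pi>"
    if J: "finite_category J" and G: "is_functor J (SCan N \<iota>) G" and L: "limit_cone J (SCan N \<iota>) G L \<pi>"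
    for J :: "(nat, nat) category" and G L \<pi>
  proof -
    obtain L' \<pi>' where L': "limit_cone J N G L' \<pi>'" "limit_cone J (SCan N \<iota>) G L' \<pi>'"
      using lim[OF J G] by blast
    obtain u v where uv: "inverse_arrows (SCan N \<iota>) u v" "u \<in> hom (SCan N \<iota>) L L'"
      "\<And>i. i \<in> Obj J \<Longrightarrow> \<pi>' i \<cdot>\<^bsub>SCan N \<iota>\<^esub> u = \<pi> i"
      using limit_cone_comparison[OF category_SCan L'(2) L] by blast
    show ?thesis
      by (rule limit_cone_iso[OF _ L'(1), of u v])
        (use G uv in \<open>auto simp: is_functor_SCan_iff inverse_arrows_def hom_SCan_iff\<close>)
  qed
  moreover have "has_finite_limits (SCan N \<iota>)"
    using lim unfolding has_finite_limits_def by blast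
  ultimately show "lex_subcategory (SCan N \<iota>) N"
    unfolding lex_subcategory_def lex_subcategory_axioms_def
    using sub category_SCan NM.C.category_axioms
    by (simp add: preserves_finite_limits_def)
qed

end

section \<open>Power objects of strongly Cantorian objects\<close>

lemma product_arrow:
  assumes "is_product C A B W p q" "f \<in> hom C X A" "g \<in> hom C X B"
  obtains h where "h \<in> hom C X W" "p \<cdot>\<^bsub>C\<^esub> h = f" "q \<cdot>\<^bsub>C\<^esub> h = g"
  using assms unfolding is_product_def by blast

lemma product_arrow_eqI:
  assumes "category C" "is_product C A B W p q" "x \<in> hom C X W" "y \<in> hom C X W"
    and "p \<cdot>\<^bsub>C\<^esub> x = p \<cdot>\<^bsub>C\<^esub> y" "q \<cdot>\<^bsub>C\<^esub> x = q \<cdot>\<^bsub>C\<^esub> y"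
  shows "x = y"
proof -
  have "p \<cdot>\<^bsub>C\<^esub> y \<in> hom C X A" "q \<cdot>\<^bsub>C\<^esub> y \<in> hom C X B"
    using assms(2,4) category.Comp_in_hom[OF assms(1)] by (auto simp: is_product_def)
  then have "\<exists>!h. h \<in> hom C X W \<and> p \<cdot>\<^bsub>C\<^esub> h = p \<cdot>\<^bsub>C\<^esub> y \<and> q \<cdot>\<^bsub>C\<^esub> h = q \<cdot>\<^bsub>C\<^esub> y"
    using assms(2) unfolding is_product_def by blast
  then show ?thesis using assms by blast
qed

lemma (in category) Comp_left_cong:
  assumes "g \<cdot> f = g' \<cdot> f'"
    and "x \<in> Arr C" "f \<in> Arr C" "g \<in> Arr C" "Cod C x = Dom C f" "Cod C f = Dom C g"
    and "f' \<in> Arr C" "g' \<in> Arr C" "Cod C x = Dom C f'" "Cod C f' = Dom C g'"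
  shows "g \<cdot> (f \<cdot> x) = g' \<cdot> (f' \<cdot> x)"
  using assms Comp_assoc_arr[of x f g] Comp_assoc_arr[of x f' g'] by simp

context IMLU_category
begin

(* These two rules reduce membership in N to membership in SCan, which unfolds to membership
   in N again, so the simplifier would loop on them. *)
declare SN.Obj_D [simp del] SN.Arr_D [simp del]

lemma product_SCan:
  assumes A: "strongly_Cantorian N \<iota> A" and B: "strongly_Cantorian N \<iota> B"
    and W: "is_product N A B W p q"
  shows "is_product (SCan N \<iota>) A B W p q"
proof -
  have AB: "A \<in> Obj N" "B \<in> Obj N" using A B by (auto simp: strongly_Cantorian_iff)
  have "strongly_Cantorian N \<iota> W"
    by (rule strongly_Cantorian_limit[OF finite_pair_shape NM.C.is_functor_pair_diagram[OF AB]
          W[unfolded NM.C.is_product_iff_limit_cone[OF AB]]])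
      (use A B in \<open>auto simp: pair_diagram_def\<close>)
  then show ?thesis
    using A B W unfolding is_product_def by (auto simp: hom_SCan_iff)
qed

text \<open>The relation \<open>r\<close> below is \<open>T m\<close>, with codomain transported to the product \<open>V\<close> of \<open>T A\<close> and
  \<open>T (P A)\<close>. The point is that \<open>r\<close> is a mono and a pullback in \<open>M\<close> of \<open>m\<close> along \<open>id \<times> \<iota>\<inverse>\<close> at
  \<open>P A\<close>; the uniqueness of classifying arrows in \<open>M\<close> then forces \<open>\<iota>\<inverse>\<close> to be the one in \<open>N\<close>.\<close>

lemma strongly_Cantorian_P:
  assumes A: "strongly_Cantorian N \<iota> A"
  shows "strongly_Cantorian N \<iota> (obj_map P A)"
proof -
  define TA PA where "TA = obj_map T A" and "PA = obj_map P A"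
  have AN: "A \<in> Obj N" using A by (simp add: strongly_Cantorian_iff)
  have TA_SC: "strongly_Cantorian N \<iota> TA" using strongly_Cantorian_T[OF A] by (simp add: TA_def)
  have objs: "TA \<in> Obj N" "PA \<in> Obj N" "obj_map T PA \<in> Obj N"
    using AN by (simp_all add: TA_def PA_def)
  obtain E W p q m where m: "m \<in> hom N E W" "monic M m" and WN: "is_product N TA PA W p q"
    and univ: "\<And>B V p' q' R r. B \<in> Obj N \<Longrightarrow> r \<in> hom N R V \<Longrightarrow> is_product N TA B V p' q' \<Longrightarrow>
      monic M r \<Longrightarrow> \<exists>\<chi> \<in> hom N B PA. pullback_along_id_times M W p q m V p' q' r \<chi> \<and>
        (\<forall>\<chi>' \<in> hom M B PA. pullback_along_id_times M W p q m V p' q' r \<chi>' \<longrightarrow> \<chi>' = \<chi>)"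
    using power[OF AN] unfolding TA_def PA_def by blast
  obtain V p' q' where VN: "is_product N TA (obj_map T PA) V p' q'"
    using NM.C.products_exist[OF NM.has_limits objs(1,3)] by blast
  have WM: "is_product M TA PA W p q" and VM: "is_product M TA (obj_map T PA) V p' q'"
    using NM.product_D WN VN by auto
  have p: "p \<in> Arr N" "Dom M p = W" "Cod M p = TA" and q: "q \<in> Arr N" "Dom M q = W" "Cod M q = PA"
    using WN by (auto simp: is_product_def NM.hom_C_iff)
  have p': "p' \<in> Arr N" "Dom M p' = V" "Cod M p' = TA"
    and q': "q' \<in> Arr N" "Dom M q' = V" "Cod M q' = obj_map T PA"
    using VN by (auto simp: is_product_def NM.hom_C_iff)
  have m': "m \<in> Arr N" "Dom M m = E" "Cod M m = W" using m by (auto simp: NM.hom_C_iff)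
  have EW: "E \<in> Obj N" "W \<in> Obj N" using m' NM.Dom_D_in_C NM.Cod_D_in_C by auto
  have pm: "p \<cdot>\<^bsub>M\<^esub> m \<in> Arr N" "q \<cdot>\<^bsub>M\<^esub> m \<in> Arr N" using p q m' NM.Comp_D_in_C by auto

  (* f and g are the two components of r. The inverse of iota at T A lies in N because T A
     is strongly Cantorian along with A. *)
  define f where "f = iota_inv TA \<cdot>\<^bsub>M\<^esub> arr_map T (p \<cdot>\<^bsub>M\<^esub> m)"
  define g where "g = arr_map T (q \<cdot>\<^bsub>M\<^esub> m)"
  have f: "f \<in> hom N (obj_map T E) TA"
    using NM.Comp_D_in_C[of "arr_map T (p \<cdot>\<^bsub>M\<^esub> m)" "iota_inv TA"] iota_inv_in_N[OF TA_SC] pm p m' objs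
    by (auto simp: f_def NM.hom_C_iff)
  have g: "g \<in> hom N (obj_map T E) (obj_map T PA)"
    using pm q m' by (auto simp: g_def NM.hom_C_iff)
  have f_eq: "f = p \<cdot>\<^bsub>M\<^esub> (m \<cdot>\<^bsub>M\<^esub> iota_inv E)"
    using iota_inv_natural[of "p \<cdot>\<^bsub>M\<^esub> m"] pm p m' EW NM.D.Comp_assoc_arr[of "iota_inv E" m p]
    by (simp add: f_def)
  have g_eq: "iota_inv PA \<cdot>\<^bsub>M\<^esub> g = q \<cdot>\<^bsub>M\<^esub> (m \<cdot>\<^bsub>M\<^esub> iota_inv E)"
    using iota_inv_natural[of "q \<cdot>\<^bsub>M\<^esub> m"] pm q m' EW NM.D.Comp_assoc_arr[of "iota_inv E" m q]
    by (simp add: g_def)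
  obtain r where r: "r \<in> hom N (obj_map T E) V" and "p' \<cdot>\<^bsub>N\<^esub> r = f" "q' \<cdot>\<^bsub>N\<^esub> r = g"
    using product_arrow[OF VN f g] by blast
  then have rN: "r \<in> Arr N" "Dom M r = obj_map T E" "Cod M r = V"
    and r_eq: "p' \<cdot>\<^bsub>M\<^esub> r = f" "q' \<cdot>\<^bsub>M\<^esub> r = g"
    using p' q' by (auto simp: NM.hom_C_iff)
  have "p' \<in> hom M V TA" "iota_inv PA \<cdot>\<^bsub>M\<^esub> q' \<in> hom M V PA"
    using p' q' objs by (auto simp: hom_def)
  then obtain h where "h \<in> hom M V W" and h_eq: "p \<cdot>\<^bsub>M\<^esub> h = p'" "q \<cdot>\<^bsub>M\<^esub> h = iota_inv PA \<cdot>\<^bsub>M\<^esub> q'"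
    using product_arrow[OF WM] by blast
  then have h: "h \<in> Arr M" "Dom M h = V" "Cod M h = W" by (auto simp: hom_def)
  have ph: "p \<cdot>\<^bsub>M\<^esub> (h \<cdot>\<^bsub>M\<^esub> x) = p' \<cdot>\<^bsub>M\<^esub> x" if "x \<in> Arr M" "Cod M x = V" for x
    using NM.D.Comp_assoc_arr[of x h p] that h p h_eq by simp
  have qh: "q \<cdot>\<^bsub>M\<^esub> (h \<cdot>\<^bsub>M\<^esub> x) = iota_inv PA \<cdot>\<^bsub>M\<^esub> (q' \<cdot>\<^bsub>M\<^esub> x)" if "x \<in> Arr M" "Cod M x = V" for x
    using NM.D.Comp_left_cong[OF h_eq(2), of x] that h q q' objs by simp
  (* h is id times the inverse of iota at P A; the pullback square commutes by naturality. *)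
  have hr: "h \<cdot>\<^bsub>M\<^esub> r = m \<cdot>\<^bsub>M\<^esub> iota_inv E"
    by (rule product_arrow_eqI[OF NM.D.category_axioms WM, of _ "obj_map T E"])
      (use h rN m' EW ph qh r_eq f_eq g_eq in \<open>auto simp: hom_def\<close>)
  have hrx: "h \<cdot>\<^bsub>M\<^esub> (r \<cdot>\<^bsub>M\<^esub> x) = m \<cdot>\<^bsub>M\<^esub> (iota_inv E \<cdot>\<^bsub>M\<^esub> x)"
    if "x \<in> Arr M" "Cod M x = obj_map T E" for x
    using NM.D.Comp_left_cong[OF hr, of x] that h rN m' EW by simp
  have m_inj: "x = y" if "x \<in> hom M X E" "y \<in> hom M X E" "m \<cdot>\<^bsub>M\<^esub> x = m \<cdot>\<^bsub>M\<^esub> y" for X x y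
    using m(2) that m' unfolding monic_def by blast
  have r_inj: "x = y"
    if x: "x \<in> hom M X (obj_map T E)" and y: "y \<in> hom M X (obj_map T E)"
      and xy: "r \<cdot>\<^bsub>M\<^esub> x = r \<cdot>\<^bsub>M\<^esub> y" for X x y
  proof -
    have xy': "x \<in> Arr M" "Dom M x = X" "Cod M x = obj_map T E"
        "y \<in> Arr M" "Dom M y = X" "Cod M y = obj_map T E"
      using x y by (auto simp: hom_def)
    have "m \<cdot>\<^bsub>M\<^esub> (iota_inv E \<cdot>\<^bsub>M\<^esub> x) = m \<cdot>\<^bsub>M\<^esub> (iota_inv E \<cdot>\<^bsub>M\<^esub> y)"
      using hrx[of x] hrx[of y] xy xy' by simp
    with _ _ have "iota_inv E \<cdot>\<^bsub>M\<^esub> x = iota_inv E \<cdot>\<^bsub>M\<^esub> y"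
      by (rule m_inj[of _ X]) (use xy' EW in \<open>auto simp: hom_def\<close>)
    then have "\<iota> E \<cdot>\<^bsub>M\<^esub> (iota_inv E \<cdot>\<^bsub>M\<^esub> x) = \<iota> E \<cdot>\<^bsub>M\<^esub> (iota_inv E \<cdot>\<^bsub>M\<^esub> y)" by simp
    then show ?thesis using xy' EW by simp
  qed
  then have r_monic: "monic M r" using rN by (auto simp: monic_def)
  have "is_pullback M h m r (iota_inv E)"
    unfolding is_pullback_def
  proof (intro conjI allI ballI impI)
    fix X a b
    assume a: "a \<in> hom M X (Dom M h)" and b: "b \<in> hom M X (Dom M m)" and ab: "h \<cdot>\<^bsub>M\<^esub> a = m \<cdot>\<^bsub>M\<^esub> b"
    have a': "a \<in> Arr M" "Dom M a = X" "Cod M a = V" and b': "b \<in> Arr M" "Dom M b = X" "Cod M b = E"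
      using a b h m' by (auto simp: hom_def)
    (* The side opposite to h is invertible, so b alone determines the induced arrow. *)
    define u where "u = \<iota> E \<cdot>\<^bsub>M\<^esub> b"
    have u: "u \<in> Arr M" "Dom M u = X" "Cod M u = obj_map T E" "iota_inv E \<cdot>\<^bsub>M\<^esub> u = b"
      using b' EW by (simp_all add: u_def)
    have hra: "h \<cdot>\<^bsub>M\<^esub> (r \<cdot>\<^bsub>M\<^esub> u) = h \<cdot>\<^bsub>M\<^esub> a" using hrx[of u] u ab by simp
    have "r \<cdot>\<^bsub>M\<^esub> u = a"
    proof (rule product_arrow_eqI[OF NM.D.category_axioms VM, of _ X])
      show "r \<cdot>\<^bsub>M\<^esub> u \<in> hom M X V" "a \<in> hom M X V" using rN u a' by (auto simp: hom_def)
      show "p' \<cdot>\<^bsub>M\<^esub> (r \<cdot>\<^bsub>M\<^esub> u) = p' \<cdot>\<^bsub>M\<^esub> a"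
        using ph[of "r \<cdot>\<^bsub>M\<^esub> u"] ph[of a] hra rN u a' by simp
      have "iota_inv PA \<cdot>\<^bsub>M\<^esub> (q' \<cdot>\<^bsub>M\<^esub> (r \<cdot>\<^bsub>M\<^esub> u)) = iota_inv PA \<cdot>\<^bsub>M\<^esub> (q' \<cdot>\<^bsub>M\<^esub> a)"
        using qh[of "r \<cdot>\<^bsub>M\<^esub> u"] qh[of a] hra rN u a' by simp
      then have "\<iota> PA \<cdot>\<^bsub>M\<^esub> (iota_inv PA \<cdot>\<^bsub>M\<^esub> (q' \<cdot>\<^bsub>M\<^esub> (r \<cdot>\<^bsub>M\<^esub> u)))
          = \<iota> PA \<cdot>\<^bsub>M\<^esub> (iota_inv PA \<cdot>\<^bsub>M\<^esub> (q' \<cdot>\<^bsub>M\<^esub> a))" by simp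
      then show "q' \<cdot>\<^bsub>M\<^esub> (r \<cdot>\<^bsub>M\<^esub> u) = q' \<cdot>\<^bsub>M\<^esub> a" using q' rN u a' objs by simp
    qed
    moreover have uX: "u \<in> hom M X (obj_map T E)" using u by (simp add: hom_def)
    ultimately show "\<exists>!k. k \<in> hom M X (Dom M r) \<and> r \<cdot>\<^bsub>M\<^esub> k = a \<and> iota_inv E \<cdot>\<^bsub>M\<^esub> k = b"
      unfolding rN(2) using u(4) r_inj[OF _ uX] by (metis (no_types))
  qed (use h m' rN EW hr in auto)
  then have pb: "pullback_along_id_times M W p q m V p' q' r (iota_inv PA)"
    unfolding pullback_along_id_times_def using h h_eq by (auto simp: hom_def)
  moreover have "iota_inv PA \<in> hom M (obj_map T PA) PA" using objs by (auto simp: hom_def)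
  ultimately have "iota_inv PA \<in> hom N (obj_map T PA) PA"
    using univ[OF objs(3) r VN r_monic] by blast
  then show ?thesis using strongly_Cantorian_if_iota_inv objs by (simp add: hom_def PA_def)
qed

text \<open>An induced arrow of \<open>M\<close> into such a pullback lies in \<open>N\<close> because its composite with the mono
  \<open>r\<close> does.\<close>

lemma pullback_SCan:
  assumes pb: "is_pullback M h m r k" and r: "monic M r"
    and ar: "h \<in> Arr (SCan N \<iota>)" "m \<in> Arr (SCan N \<iota>)" "r \<in> Arr (SCan N \<iota>)" "k \<in> Arr (SCan N \<iota>)"
  shows "is_pullback (SCan N \<iota>) h m r k"
proof -
  have dc: "Cod M h = Cod M m" "Dom M r = Dom M k" "Cod M r = Dom M h" "Cod M k = Dom M m"
    and sq: "h \<cdot>\<^bsub>M\<^esub> r = m \<cdot>\<^bsub>M\<^esub> k"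
    using pb by (auto simp: is_pullback_def)
  have arN: "h \<in> Arr N" "m \<in> Arr N" "r \<in> Arr N" "k \<in> Arr N" using ar by auto
  have "\<exists>!u. u \<in> hom (SCan N \<iota>) X (Dom M r) \<and> r \<cdot>\<^bsub>N\<^esub> u = a \<and> k \<cdot>\<^bsub>N\<^esub> u = b"
    if a: "a \<in> hom (SCan N \<iota>) X (Dom M h)" and b: "b \<in> hom (SCan N \<iota>) X (Dom M m)"
      and ab: "h \<cdot>\<^bsub>N\<^esub> a = m \<cdot>\<^bsub>N\<^esub> b" for X a b
  proof -
    have a': "a \<in> Arr N" "Dom M a = X" "Cod M a = Dom M h" "strongly_Cantorian N \<iota> X"
      and b': "b \<in> Arr N" "Dom M b = X" "Cod M b = Dom M m"
      using a b by (auto simp: hom_SCan_iff NM.hom_C_iff)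
    have "a \<in> hom M X (Dom M h)" "b \<in> hom M X (Dom M m)" "h \<cdot>\<^bsub>M\<^esub> a = m \<cdot>\<^bsub>M\<^esub> b"
      using a' b' ab arN by (auto simp: hom_def)
    then have ex: "\<exists>!u. u \<in> hom M X (Dom M r) \<and> r \<cdot>\<^bsub>M\<^esub> u = a \<and> k \<cdot>\<^bsub>M\<^esub> u = b"
      using pb unfolding is_pullback_def by blast
    then obtain u where u: "u \<in> hom M X (Dom M r)" "r \<cdot>\<^bsub>M\<^esub> u = a" "k \<cdot>\<^bsub>M\<^esub> u = b" by blast
    have uN: "u \<in> Arr N"
      by (rule factor_in_N[OF a'(1) arN(3) r _ _ u(2)]) (use u(1) in \<open>auto simp: hom_def\<close>)
    show ?thesis
    proof (rule ex1I[of _ u])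
      show "u \<in> hom (SCan N \<iota>) X (Dom M r) \<and> r \<cdot>\<^bsub>N\<^esub> u = a \<and> k \<cdot>\<^bsub>N\<^esub> u = b"
        using u uN a' arN dc ar(3) by (auto simp: hom_SCan_iff NM.hom_C_iff hom_def[of M])
      fix v assume v: "v \<in> hom (SCan N \<iota>) X (Dom M r) \<and> r \<cdot>\<^bsub>N\<^esub> v = a \<and> k \<cdot>\<^bsub>N\<^esub> v = b"
      then have "v \<in> Arr N" "Dom M v = X" "Cod M v = Dom M r" by (auto simp: hom_SCan_iff NM.hom_C_iff)
      then have "v \<in> hom M X (Dom M r) \<and> r \<cdot>\<^bsub>M\<^esub> v = a \<and> k \<cdot>\<^bsub>M\<^esub> v = b"
        using v arN dc by (auto simp: hom_def[of M])
      then show "v = u" using ex u by blast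
    qed
  qed
  then show ?thesis
    using ar dc sq unfolding is_pullback_def by auto
qed

text \<open>Classification in \<open>SCan\<close> uses products with \<open>A\<close>, whereas the power objects of \<open>N\<close> use products
  with \<open>T A\<close>. The isomorphism \<open>\<iota> A\<close> translates between the two; the arrows \<open>h\<close> and \<open>k\<close> of the
  square are automatically in \<open>N\<close>, the first by the product \<open>W\<close> in \<open>N\<close>, the second because \<open>m\<close>
  is monic.\<close>

lemma pullback_along_id_times_SCan_iff:
  assumes A: "strongly_Cantorian N \<iota> A"
    and W: "is_product N (obj_map T A) PA W p q"
    and V: "is_product N A B V p' q'"
    and SC: "strongly_Cantorian N \<iota> W" "strongly_Cantorian N \<iota> V"
    and m: "m \<in> hom (SCan N \<iota>) E W" "monic M m"
    and r: "r \<in> hom (SCan N \<iota>) R V" "monic M r"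
    and \<chi>: "\<chi> \<in> hom N B PA"
  shows "pullback_along_id_times (SCan N \<iota>) W (iota_inv A \<cdot>\<^bsub>N\<^esub> p) q m V p' q' r \<chi> \<longleftrightarrow>
    pullback_along_id_times M W p q m V (\<iota> A \<cdot>\<^bsub>N\<^esub> p') q' r \<chi>" (is "?l \<longleftrightarrow> ?r")
proof -
  have AN: "A \<in> Obj N" "\<iota> A \<in> Arr N" "iota_inv A \<in> Arr N"
    using A iota_inv_in_N by (auto simp: strongly_Cantorian_iff)
  have WM: "is_product M (obj_map T A) PA W p q" using NM.product_D[OF W] .
  have p: "p \<in> Arr N" "Dom M p = W" "Cod M p = obj_map T A"
    and q: "q \<in> Arr N" "Dom M q = W" "Cod M q = PA"
    using W by (auto simp: is_product_def NM.hom_C_iff)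
  have p': "p' \<in> Arr N" "Dom M p' = V" "Cod M p' = A"
    and q': "q' \<in> Arr N" "Dom M q' = V" "Cod M q' = B"
    using V by (auto simp: is_product_def NM.hom_C_iff)
  have m': "m \<in> Arr N" "Dom M m = E" "Cod M m = W" and r': "r \<in> Arr N" "Dom M r = R" "Cod M r = V"
    using m r by (auto simp: hom_SCan_iff NM.hom_C_iff)
  have \<chi>': "\<chi> \<in> Arr N" "Dom M \<chi> = B" "Cod M \<chi> = PA" using \<chi> by (auto simp: NM.hom_C_iff)
  have fst: "(iota_inv A \<cdot>\<^bsub>M\<^esub> p) \<cdot>\<^bsub>M\<^esub> h = p' \<longleftrightarrow> p \<cdot>\<^bsub>M\<^esub> h = \<iota> A \<cdot>\<^bsub>M\<^esub> p'"
    if h: "h \<in> Arr M" "Dom M h = V" "Cod M h = W" for h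
  proof -
    have "(iota_inv A \<cdot>\<^bsub>M\<^esub> p) \<cdot>\<^bsub>M\<^esub> h = iota_inv A \<cdot>\<^bsub>M\<^esub> (p \<cdot>\<^bsub>M\<^esub> h)"
      by (rule NM.D.Comp_assoc_arr) (use h p AN in auto)
    moreover have "iota_inv A \<cdot>\<^bsub>M\<^esub> (\<iota> A \<cdot>\<^bsub>M\<^esub> p') = p'" using p' by simp
    moreover have "\<iota> A \<cdot>\<^bsub>M\<^esub> (iota_inv A \<cdot>\<^bsub>M\<^esub> (p \<cdot>\<^bsub>M\<^esub> h)) = p \<cdot>\<^bsub>M\<^esub> h" using AN p h by simp
    ultimately show ?thesis by metis
  qed
  show ?thesis
  proof
    assume ?l
    then obtain h k where h: "h \<in> hom (SCan N \<iota>) V W" and eqs: "(iota_inv A \<cdot>\<^bsub>N\<^esub> p) \<cdot>\<^bsub>N\<^esub> h = p'"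
        "q \<cdot>\<^bsub>N\<^esub> h = \<chi> \<cdot>\<^bsub>N\<^esub> q'" and pb: "is_pullback (SCan N \<iota>) h m r k"
      by (auto simp: pullback_along_id_times_def)
    have h': "h \<in> Arr N" "Dom M h = V" "Cod M h = W"
      using h by (auto simp: hom_SCan_iff NM.hom_C_iff)
    have "p \<cdot>\<^bsub>M\<^esub> h = \<iota> A \<cdot>\<^bsub>N\<^esub> p'" "q \<cdot>\<^bsub>M\<^esub> h = \<chi> \<cdot>\<^bsub>M\<^esub> q'"
      using eqs fst[of h] h' AN p p' q q' \<chi>' NM.Comp_D_in_C[of p "iota_inv A"] by auto
    moreover have "is_pullback M h m r k" using NM.pullback_D[OF SN.pullback_D[OF pb]] .
    moreover have "h \<in> hom M V W" using h' by (simp add: hom_def)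
    ultimately show ?r unfolding pullback_along_id_times_def by blast
  next
    assume ?r
    then obtain h k where h: "h \<in> Arr M" "Dom M h = V" "Cod M h = W"
      and eqs: "p \<cdot>\<^bsub>M\<^esub> h = \<iota> A \<cdot>\<^bsub>M\<^esub> p'" "q \<cdot>\<^bsub>M\<^esub> h = \<chi> \<cdot>\<^bsub>M\<^esub> q'" and pb: "is_pullback M h m r k"
      using AN p' by (auto simp: pullback_along_id_times_def hom_def)
    have "\<iota> A \<cdot>\<^bsub>N\<^esub> p' \<in> hom N V (obj_map T A)" "\<chi> \<cdot>\<^bsub>N\<^esub> q' \<in> hom N V PA"
      using AN p' q' \<chi>' NM.Comp_D_in_C[of p' "\<iota> A"] NM.Comp_D_in_C[of q' \<chi>]
      by (auto simp: NM.hom_C_iff)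
    then obtain h0 where "h0 \<in> hom N V W" "p \<cdot>\<^bsub>N\<^esub> h0 = \<iota> A \<cdot>\<^bsub>N\<^esub> p'" "q \<cdot>\<^bsub>N\<^esub> h0 = \<chi> \<cdot>\<^bsub>N\<^esub> q'"
      using product_arrow[OF W] by blast
    then have h0: "h0 \<in> Arr N" "Dom M h0 = V" "Cod M h0 = W"
      "p \<cdot>\<^bsub>M\<^esub> h0 = \<iota> A \<cdot>\<^bsub>M\<^esub> p'" "q \<cdot>\<^bsub>M\<^esub> h0 = \<chi> \<cdot>\<^bsub>M\<^esub> q'"
      using AN p p' q q' \<chi>' by (auto simp: NM.hom_C_iff)
    have "h = h0"
      by (rule product_arrow_eqI[OF NM.D.category_axioms WM, of _ V])
        (use h h0 eqs in \<open>auto simp: hom_def\<close>)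
    then have hN: "h \<in> Arr N" using h0 by simp
    have k: "k \<in> Arr M" "Dom M k = R" "Cod M k = E" and sq: "m \<cdot>\<^bsub>M\<^esub> k = h \<cdot>\<^bsub>M\<^esub> r"
      using pb m' r' by (auto simp: is_pullback_def)
    have "h \<cdot>\<^bsub>M\<^esub> r \<in> Arr N" using NM.Comp_D_in_C[of r h] hN h r' by simp
    then have kN: "k \<in> Arr N"
      by (rule factor_in_N[OF _ m'(1) m(2) _ _ sq]) (use k m' in auto)
    have "is_pullback (SCan N \<iota>) h m r k"
      by (rule pullback_SCan[OF pb r(2)])
        (use h hN kN k m r SC in \<open>auto simp: hom_SCan_iff NM.hom_C_iff\<close>)
    moreover have "(iota_inv A \<cdot>\<^bsub>N\<^esub> p) \<cdot>\<^bsub>N\<^esub> h = p'" "q \<cdot>\<^bsub>N\<^esub> h = \<chi> \<cdot>\<^bsub>N\<^esub> q'"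
      using eqs fst[of h] h hN AN p p' q q' \<chi>' NM.Comp_D_in_C[of p "iota_inv A"] by auto
    ultimately show ?l
      using h hN SC unfolding pullback_along_id_times_def
      by (auto simp: hom_SCan_iff NM.hom_C_iff)
  qed
qed

lemma has_power_objects_SCan: "has_power_objects (SCan N \<iota>)"
  unfolding has_power_objects_def
proof
  fix A assume "A \<in> Obj (SCan N \<iota>)"
  then have A: "strongly_Cantorian N \<iota> A" by simp
  define PA where "PA = obj_map P A"
  have AN: "A \<in> Obj N" using A by (simp add: strongly_Cantorian_iff)
  have PA: "strongly_Cantorian N \<iota> PA" using strongly_Cantorian_P[OF A] by (simp add: PA_def)
  obtain E W p q m where m: "m \<in> hom N E W" "monic M m"
    and WN: "is_product N (obj_map T A) PA W p q"
    and univ: "\<And>B V p' q' R r. B \<in> Obj N \<Longrightarrow> r \<in> hom N R V \<Longrightarrow>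
      is_product N (obj_map T A) B V p' q' \<Longrightarrow>
      monic M r \<Longrightarrow> \<exists>\<chi> \<in> hom N B PA. pullback_along_id_times M W p q m V p' q' r \<chi> \<and>
        (\<forall>\<chi>' \<in> hom M B PA. pullback_along_id_times M W p q m V p' q' r \<chi>' \<longrightarrow> \<chi>' = \<chi>)"
    using power[OF AN] unfolding PA_def by blast
  have W: "is_product (SCan N \<iota>) A PA W (iota_inv A \<cdot>\<^bsub>N\<^esub> p) q"
    using product_SCan[OF A PA]
      NM.C.product_iso_fst[OF WN inverse_arrows_sym[OF inverse_arrows_iota_N[OF A]]]
      AN iota_inv_in_N[OF A] by simp
  then have W_SC: "strongly_Cantorian N \<iota> W" by (simp add: is_product_def)
  have mS: "m \<in> hom (SCan N \<iota>) E W"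
    using strongly_Cantorian_subobject[of m] m W_SC by (auto simp: hom_SCan_iff NM.hom_C_iff)
  have m_monic: "m \<in> monos_into (SCan N \<iota>) W"
    using SN.monic_C[of m] NM.monic_C[of m] m mS by (auto simp: monos_into_def hom_def)
  have "\<exists>!\<chi>. \<chi> \<in> hom (SCan N \<iota>) B PA \<and>
      pullback_along_id_times (SCan N \<iota>) W (iota_inv A \<cdot>\<^bsub>N\<^esub> p) q m V p' q' r \<chi>"
    if B: "B \<in> Obj (SCan N \<iota>)" and V: "is_product (SCan N \<iota>) A B V p' q'"
      and r: "r \<in> monos_into (SCan N \<iota>) V" for B V p' q' r
  proof -
    have BN: "B \<in> Obj N" using B by (simp add: strongly_Cantorian_iff)
    have VN: "is_product N A B V p' q'" using SN.product_D[OF V] .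
    have VT: "is_product N (obj_map T A) B V (\<iota> A \<cdot>\<^bsub>N\<^esub> p') q'"
      using NM.C.product_iso_fst[OF VN inverse_arrows_iota_N[OF A]] A AN
      by (simp add: strongly_Cantorian_iff)
    have V_SC: "strongly_Cantorian N \<iota> V" using V by (simp add: is_product_def)
    have rS: "r \<in> hom (SCan N \<iota>) (Dom M r) V"
      using r by (auto simp: monos_into_def monic_def hom_def)
    have r_monic: "monic M r" using r NM.monic_D[OF SN.monic_D] by (simp add: monos_into_def)
    note iff = pullback_along_id_times_SCan_iff[OF A WN VN W_SC V_SC mS m(2) rS r_monic]
    obtain \<chi> where \<chi>: "\<chi> \<in> hom N B PA" "pullback_along_id_times M W p q m V (\<iota> A \<cdot>\<^bsub>N\<^esub> p') q' r \<chi>"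
      and uniq: "\<And>\<chi>'. \<chi>' \<in> hom M B PA \<Longrightarrow>
        pullback_along_id_times M W p q m V (\<iota> A \<cdot>\<^bsub>N\<^esub> p') q' r \<chi>' \<Longrightarrow> \<chi>' = \<chi>"
      using univ[OF BN _ VT r_monic] rS unfolding hom_SCan_iff by blast
    show ?thesis
    proof (rule ex1I[of _ \<chi>])
      show "\<chi> \<in> hom (SCan N \<iota>) B PA \<and>
          pullback_along_id_times (SCan N \<iota>) W (iota_inv A \<cdot>\<^bsub>N\<^esub> p) q m V p' q' r \<chi>"
        using \<chi> iff[OF \<chi>(1)] B PA by (simp add: hom_SCan_iff)
      fix \<chi>' assume \<chi>': "\<chi>' \<in> hom (SCan N \<iota>) B PA \<and>
          pullback_along_id_times (SCan N \<iota>) W (iota_inv A \<cdot>\<^bsub>N\<^esub> p) q m V p' q' r \<chi>'"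
      then have \<chi>'N: "\<chi>' \<in> hom N B PA" by (simp add: hom_SCan_iff)
      show "\<chi>' = \<chi>"
      proof (rule uniq)
        show "\<chi>' \<in> hom M B PA" using \<chi>'N by (auto simp: NM.hom_C_iff hom_def[of M])
        show "pullback_along_id_times M W p q m V (\<iota> A \<cdot>\<^bsub>N\<^esub> p') q' r \<chi>'"
          using \<chi>' iff[OF \<chi>'N] by simp
      qed
    qed
  qed
  then have "\<forall>B \<in> Obj (SCan N \<iota>). \<forall>V p' q' r.
      is_product (SCan N \<iota>) A B V p' q' \<and> r \<in> monos_into (SCan N \<iota>) V \<longrightarrow>
      (\<exists>!\<chi>. \<chi> \<in> hom (SCan N \<iota>) B PA \<and>
        pullback_along_id_times (SCan N \<iota>) W (iota_inv A \<cdot>\<^bsub>N\<^esub> p) q m V p' q' r \<chi>)"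
    by blast
  moreover have "PA \<in> Obj (SCan N \<iota>)" using PA by simp
  ultimately show "\<exists>PA \<in> Obj (SCan N \<iota>). \<exists>W p q m. is_product (SCan N \<iota>) A PA W p q \<and>
      m \<in> monos_into (SCan N \<iota>) W \<and>
      (\<forall>B \<in> Obj (SCan N \<iota>). \<forall>V p' q' r.
        is_product (SCan N \<iota>) A B V p' q' \<and> r \<in> monos_into (SCan N \<iota>) V \<longrightarrow>
        (\<exists>!\<chi>. \<chi> \<in> hom (SCan N \<iota>) B PA \<and>
          pullback_along_id_times (SCan N \<iota>) W p q m V p' q' r \<chi>))"
    using W m_monic by blast
qed

end

theorem theorem7p3p7:
  fixes M N :: "('o, 'm) category"
    and U :: 'o
    and T P :: "('o, 'm, 'o, 'm) functor_data"
    and \<iota> \<mu> :: "'o \<Rightarrow> 'm"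
  assumes "IMLU_category M N U T \<iota> P \<mu>"
  shows "topos (SCan N \<iota>)"
proof -
  interpret IMLU_category M N U T \<iota> P \<mu> by (rule assms)
  show ?thesis
    using category_SCan SN.has_limits has_power_objects_SCan by (simp add: topos_def)
qed

end
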